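(* Let $p$ be a point on a smooth surface $M$ in $\mathbb R^4$ and let $\pi$ be a $2$-plane such that the projection $P_\pi$ has a fold singularity at $p$. If ${\bf u}\in T_pM\cap\pi$, then the Lipschitz--Killing curvature $K^\nu(p)$ is equal to the product of the curvature $\kappa_{ac}$ of the apparent contour and the Koenderink factor $\sigma_{\bf u}({\bf w})$, namely $$K^\nu(p)=\kappa_{ac}\cdot\sigma_{\bf u}({\bf w}).$$
   Context: Setting. With $p$ at the origin, $M$ is in Monge form $F(x,y)=(x,y,f^1(x,y),f^2(x,y))$ with $f^1,f^2$ having zero 1-jet; ${\bf e}_1,\dots,{\bf e}_4$ is the standard orthonormal basis, $T_pM=\langle{\bf e}_1,{\bf e}_2\rangle$, $N_pM=\langle{\bf e}_3,{\bf e}_4\rangle$. The plane $\pi$ satisfies $\dim(T_pM\cap\pi)=1$ and is spanned by ${\bf u}=(1,\alpha,0,0)\in T_pM\cap\pi$ and ${\bf v}=(0,\lambda,\mu,\beta)$ with $\mu^2+\beta^2\ne0$; put ${\bf w}=(0,0,\beta,-\mu)\in N_pM$. Projection along $\pi$: the map germ $(\mathbb R^2,0)\to(\mathbb R^2,0)$ $$P_\pi(x,y)=\Big(y-\alpha x-\tfrac{\lambda}{\mu^2+\beta^2}(\mu f^1+\beta f^2),\ \beta f^1-\mu f^2\Big).$$ Taking the first component as new coordinate $y$ in the source, $P_\pi=(y,g(x,y))$. Fold means $\mathcal A$-equivalent (smooth coordinate changes in source and target) to $(x,y^2)$. The contour generator $\Sigma_\pi=\{g_x=0\}$ is the singular set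 of $P_\pi$; the apparent contour is $P_\pi(\Sigma_\pi)$, which in the fold case is a regular curve parametrised by $t\mapsto(t,g(x(t),t))$ with $x(0)=0$. $\kappa_{ac}$ is its curvature at $t=0$ in these coordinates, i.e. its 2-jet is $(t,\tfrac{\kappa_{ac}}2t^2)$. Second fundamental form: $II_p({\bf u},{\bf u})=(aw_1^2+2bw_1w_2+cw_2^2){\bf e}_3+(lw_1^2+2mw_1w_2+nw_2^2){\bf e}_4$ for ${\bf u}=w_1{\bf e}_1+w_2{\bf e}_2$, where $a,b,c$ (resp. $l,m,n$) are $f^1_{xx},f^1_{xy},f^1_{yy}$ (resp. $f^2_{xx},f^2_{xy},f^2_{yy}$) at the origin. The Koenderink factor is $\sigma_{\bf u}({\bf w})=\langle II_p({\bf u},{\bf u}),{\bf w}\rangle$. The Lipschitz--Killing curvature along a normal field $\nu$ with $\nu(p)={\bf w}=\lambda_1{\bf e}_3+\lambda_2{\bf e}_4$ is the determinant of the shape operator along $\nu$ at $p$: $$K^\nu(p)=(ac-b^2)\lambda_1^2+(an+cl-2bm)\lambda_1\lambda_2+(ln-m^2)\lambda_2^2.$$ *)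

theory Defs
  imports "HOL-Analysis.Analysis"
begin

section \<open>Smooth map germs\<close>

primrec times_differentiable_on ::
  "nat \<Rightarrow> 'a::real_normed_vector set \<Rightarrow> ('a \<Rightarrow> 'b::real_normed_vector) \<Rightarrow> bool" where
  "times_differentiable_on 0 S f \<longleftrightarrow> continuous_on S f"
| "times_differentiable_on (Suc n) S f \<longleftrightarrow>
     (\<forall>x\<in>S. f differentiable (at x)) \<and>
     (\<forall>v. times_differentiable_on n S (\<lambda>x. frechet_derivative f (at x) v))"

text \<open>\<open>C\<^sup>\<infinity>\<close>; only used for open sets \<open>S\<close> of finite-dimensional spaces, where directional
  derivatives in all directions suffice.\<close>

definition smooth_on :: "'a::real_normed_vector set \<Rightarrow> ('a \<Rightarrow> 'b::real_normed_vector) \<Rightarrow> bool" where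
  "smooth_on S f \<longleftrightarrow> (\<forall>n. times_differentiable_on n S f)"

definition smooth_near :: "'a::real_normed_vector \<Rightarrow> ('a \<Rightarrow> 'b::real_normed_vector) \<Rightarrow> bool" where
  "smooth_near p f \<longleftrightarrow> (\<exists>S. open S \<and> p \<in> S \<and> smooth_on S f)"

definition diffeo_germ :: "('a::real_normed_vector \<Rightarrow> 'a) \<Rightarrow> bool" where
  "diffeo_germ \<phi> \<longleftrightarrow> \<phi> 0 = 0 \<and>
     (\<exists>U V \<phi>'. open U \<and> open V \<and> 0 \<in> U \<and> homeomorphism U V \<phi> \<phi>' \<and>
        smooth_on U \<phi> \<and> smooth_on V \<phi>')"

definition A_equivalent ::
  "('a::real_normed_vector \<Rightarrow> 'b::real_normed_vector) \<Rightarrow> ('a \<Rightarrow> 'b) \<Rightarrow> bool" where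
  "A_equivalent P Q \<longleftrightarrow>
     (\<exists>\<phi> \<psi>. diffeo_germ \<phi> \<and> diffeo_germ \<psi> \<and> (\<forall>\<^sub>F q in nhds 0. \<psi> (P q) = Q (\<phi> q)))"

definition fold_singularity :: "(real \<times> real \<Rightarrow> real \<times> real) \<Rightarrow> bool" where
  "fold_singularity P \<longleftrightarrow> A_equivalent P (\<lambda>(x, y). (x, y\<^sup>2))"

definition pd1 :: "(real \<times> real \<Rightarrow> real) \<Rightarrow> real \<times> real \<Rightarrow> real" where
  "pd1 f = (\<lambda>(x, y). deriv (\<lambda>s. f (s, y)) x)"

definition pd2 :: "(real \<times> real \<Rightarrow> real) \<Rightarrow> real \<times> real \<Rightarrow> real" where
  "pd2 f = (\<lambda>(x, y). deriv (\<lambda>s. f (x, s)) y)"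


section \<open>Surfaces in 4-space\<close>

definition tangent_space :: "'a::real_normed_vector set \<Rightarrow> 'a \<Rightarrow> 'a set" where
  "tangent_space M p =
     {v. \<exists>\<gamma>. \<gamma> 0 = p \<and> (\<forall>\<^sub>F t in nhds (0::real). \<gamma> t \<in> M) \<and> (\<gamma> has_vector_derivative v) (at 0)}"

definition monge ::
  "(real \<times> real \<Rightarrow> real) \<Rightarrow> (real \<times> real \<Rightarrow> real) \<Rightarrow> real \<times> real \<Rightarrow> real^4" where
  "monge f1 f2 = (\<lambda>(x, y). vector [x, y, f1 (x, y), f2 (x, y)])"

definition zero_1jet :: "(real \<times> real \<Rightarrow> real) \<Rightarrow> bool" where
  "zero_1jet f \<longleftrightarrow> f 0 = 0 \<and> (f has_derivative (\<lambda>_. 0)) (at 0)"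

definition in_monge_form ::
  "(real^4) set \<Rightarrow> (real \<times> real \<Rightarrow> real) \<Rightarrow> (real \<times> real \<Rightarrow> real) \<Rightarrow> bool" where
  "in_monge_form M f1 f2 \<longleftrightarrow> zero_1jet f1 \<and> zero_1jet f2 \<and>
     (\<exists>U W. open U \<and> 0 \<in> U \<and> open W \<and> smooth_on U f1 \<and> smooth_on U f2 \<and>
        M \<inter> W = monge f1 f2 ` U)"

text \<open>A normal field along \<open>M\<close> near \<open>p\<close>, given by a smooth extension to a neighbourhood of \<open>p\<close> in
  the ambient space. The derivative of the extension in directions tangent to \<open>M\<close>, which is all
  that is used below, depends only on the values along \<open>M\<close>.\<close>

definition normal_field :: "(real^4) set \<Rightarrow> real^4 \<Rightarrow> (real^4 \<Rightarrow> real^4) \<Rightarrow> bool" where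
  "normal_field M p \<nu> \<longleftrightarrow> smooth_near p \<nu> \<and>
     (\<forall>\<^sub>F z in nhds p. z \<in> M \<longrightarrow> (\<forall>v\<in>tangent_space M z. \<nu> z \<bullet> v = 0))"

text \<open>For a linear subspace \<open>T\<close>, \<open>closest_point T\<close> is the orthogonal projection onto \<open>T\<close>.\<close>

definition shape_operator ::
  "(real^4) set \<Rightarrow> real^4 \<Rightarrow> (real^4 \<Rightarrow> real^4) \<Rightarrow> real^4 \<Rightarrow> real^4" where
  "shape_operator M p \<nu> X = - closest_point (tangent_space M p) (frechet_derivative \<nu> (at p) X)"

text \<open>The standard basis vectors \<open>e1\<close>, \<open>e2\<close> form an orthonormal basis of the tangent plane at the
  origin of a surface in Monge form; the determinant of the shape operator is computed in it.\<close>

definition lipschitz_killing_curvature :: "(real^4) set \<Rightarrow> (real^4 \<Rightarrow> real^4) \<Rightarrow> real" where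
  "lipschitz_killing_curvature M \<nu> =
     (let S = shape_operator M 0 \<nu>; e1 = axis 1 1; e2 = axis 2 1
      in det (vector [vector [S e1 \<bullet> e1, S e2 \<bullet> e1],
                      vector [S e1 \<bullet> e2, S e2 \<bullet> e2]] :: real^2^2))"

text \<open>The quadratic map of the second fundamental form at the origin of a surface in Monge form.\<close>

definition second_fundamental_form ::
  "(real \<times> real \<Rightarrow> real) \<Rightarrow> (real \<times> real \<Rightarrow> real) \<Rightarrow> real^4 \<Rightarrow> real^4" where
  "second_fundamental_form f1 f2 u =
     (let q = (\<lambda>f. pd1 (pd1 f) 0 * (u$1)\<^sup>2 + 2 * pd2 (pd1 f) 0 * u$1 * u$2 + pd2 (pd2 f) 0 * (u$2)\<^sup>2)
      in q f1 *\<^sub>R axis 3 1 + q f2 *\<^sub>R axis 4 1)"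

definition koenderink_factor ::
  "(real \<times> real \<Rightarrow> real) \<Rightarrow> (real \<times> real \<Rightarrow> real) \<Rightarrow> real^4 \<Rightarrow> real^4 \<Rightarrow> real" where
  "koenderink_factor f1 f2 u w = second_fundamental_form f1 f2 u \<bullet> w"


section \<open>Projection along a plane\<close>

text \<open>The projection plane is spanned by \<open>(1, \<alpha>, 0, 0)\<close> and \<open>(0, l, \<mu>, \<beta>)\<close>.\<close>

definition proj_along :: "real \<Rightarrow> real \<Rightarrow> real \<Rightarrow> real \<Rightarrow> real^4 \<Rightarrow> real \<times> real" where
  "proj_along \<alpha> l \<mu> \<beta> z =
     (z$2 - \<alpha> * z$1 - l / (\<mu>\<^sup>2 + \<beta>\<^sup>2) * (\<mu> * z$3 + \<beta> * z$4), \<beta> * z$3 - \<mu> * z$4)"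

lemma vector_4_nth [simp]:
  "(vector [a, b, c, d] :: 'a::zero^4) $ 1 = a"
  "(vector [a, b, c, d] :: 'a::zero^4) $ 2 = b"
  "(vector [a, b, c, d] :: 'a::zero^4) $ 3 = c"
  "(vector [a, b, c, d] :: 'a::zero^4) $ 4 = d"
  unfolding vector_def by auto

lemma proj_along_kernel:
  assumes "\<mu>\<^sup>2 + \<beta>\<^sup>2 \<noteq> 0"
  shows "{z. proj_along \<alpha> l \<mu> \<beta> z = 0} =
         span {vector [1, \<alpha>, 0, 0], vector [0, l, \<mu>, \<beta>]}"
proof (intro set_eqI iffI)
  fix z :: "real^4"
  let ?D = "\<mu>\<^sup>2 + \<beta>\<^sup>2"
  assume "z \<in> {z. proj_along \<alpha> l \<mu> \<beta> z = 0}"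
  then have e: "z$2 - \<alpha> * z$1 = l / ?D * (\<mu> * z$3 + \<beta> * z$4)" "\<beta> * z$3 = \<mu> * z$4"
    by (auto simp: proj_along_def zero_prod_def)
  define t where "t = (\<mu> * z$3 + \<beta> * z$4) / ?D"
  have "(\<mu> * z$3 + \<beta> * z$4) * \<mu> = z$3 * ?D" "(\<mu> * z$3 + \<beta> * z$4) * \<beta> = z$4 * ?D"
    using e(2) by algebra+
  then have "z$3 = t * \<mu>" "z$4 = t * \<beta>"
    using assms by (simp_all add: t_def field_simps)
  moreover have "z$2 = z$1 * \<alpha> + t * l"
    using e(1) by (simp add: t_def field_simps)
  ultimately have "z = z$1 *\<^sub>R vector [1, \<alpha>, 0, 0] + t *\<^sub>R vector [0, l, \<mu>, \<beta>]"
    by (simp add: vec_eq_iff forall_4)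
  then show "z \<in> span {vector [1, \<alpha>, 0, 0], vector [0, l, \<mu>, \<beta>]}"
    by (metis insertCI span_add span_base span_scale)
next
  fix z :: "real^4"
  assume "z \<in> span {vector [1, \<alpha>, 0, 0], vector [0, l, \<mu>, \<beta>]}"
  then obtain s t where "z = s *\<^sub>R vector [1, \<alpha>, 0, 0] + t *\<^sub>R vector [0, l, \<mu>, \<beta>]"
    by (auto simp: span_insert span_singleton algebra_simps)
  moreover have "l / (\<mu>\<^sup>2 + \<beta>\<^sup>2) * (\<mu> * (t * \<mu>) + \<beta> * (t * \<beta>)) = t * l"
    using assms by (simp add: field_simps power2_eq_square)
  ultimately show "z \<in> {z. proj_along \<alpha> l \<mu> \<beta> z = 0}"
    by (simp add: proj_along_def zero_prod_def)
qed

definition surface_proj ::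
  "real \<Rightarrow> real \<Rightarrow> real \<Rightarrow> real \<Rightarrow> (real \<times> real \<Rightarrow> real) \<Rightarrow> (real \<times> real \<Rightarrow> real) \<Rightarrow>
   real \<times> real \<Rightarrow> real \<times> real" where
  "surface_proj \<alpha> l \<mu> \<beta> f1 f2 = proj_along \<alpha> l \<mu> \<beta> \<circ> monge f1 f2"


section \<open>The apparent contour\<close>

text \<open>\<open>P\<close> becomes \<open>(x, y) \<mapsto> (y, g (x, y))\<close> when its first component is taken as the new coordinate
  \<open>y\<close> in the source, the coordinate \<open>x\<close> being kept.\<close>

definition adapted_form ::
  "(real \<times> real \<Rightarrow> real \<times> real) \<Rightarrow> (real \<times> real \<Rightarrow> real) \<Rightarrow> bool" where
  "adapted_form P g \<longleftrightarrow> smooth_near 0 g \<and>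
     (\<forall>\<^sub>F (x, y) in nhds 0. P (x, y) = (fst (P (x, y)), g (x, fst (P (x, y)))))"

text \<open>The contour generator, the zero set of the first partial derivative of \<open>g\<close>, is near the
  origin the curve of points \<open>(x t, t)\<close>.\<close>

definition contour_generator_param :: "(real \<times> real \<Rightarrow> real) \<Rightarrow> (real \<Rightarrow> real) \<Rightarrow> bool" where
  "contour_generator_param g x \<longleftrightarrow> smooth_near 0 x \<and> x 0 = 0 \<and>
     (\<forall>\<^sub>F (s, t) in nhds 0. pd1 g (s, t) = 0 \<longleftrightarrow> s = x t)"

definition plane_curvature :: "(real \<Rightarrow> real \<times> real) \<Rightarrow> real \<Rightarrow> real" where
  "plane_curvature \<gamma> t =
     (let X = (\<lambda>s. fst (\<gamma> s)); Y = (\<lambda>s. snd (\<gamma> s))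
      in (deriv X t * deriv (deriv Y) t - deriv (deriv X) t * deriv Y t) /
         sqrt ((deriv X t)\<^sup>2 + (deriv Y t)\<^sup>2) ^ 3)"

text \<open>The germs of \<open>g\<close> and \<open>x\<close> are determined by the germ of \<open>P\<close> whenever they exist, which they do
  in the fold case.\<close>

definition apparent_contour_curvature :: "(real \<times> real \<Rightarrow> real \<times> real) \<Rightarrow> real" where
  "apparent_contour_curvature P =
     (THE \<kappa>. \<exists>g x. adapted_form P g \<and> contour_generator_param g x \<and>
               \<kappa> = plane_curvature (\<lambda>t. (t, g (x t, t))) 0)"

end

theory Submission
  imports Defs
begin

text \<open>Put \<open>h = \<beta> f\<^sup>1 - \<mu> f\<^sup>2\<close>, the height of the surface in the direction of \<open>w\<close>, and let \<open>p\<close> be the first component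
  of the projection, so that \<open>P = (p, h)\<close>. Everything in the formula is a function of the Hessian of
  \<open>h\<close> at the origin and of \<open>\<alpha>\<close>.

  \<^item> Differentiating \<open>\<nu> \<bullet> F\<^sub>x = \<nu> \<bullet> F\<^sub>y = 0\<close> along the surface \<open>F\<close> gives the Weingarten equations: the shape
    operator along \<open>\<nu>\<close> has at the origin the matrix of second derivatives of \<open>h\<close>, whatever the extension
    of \<open>w\<close> to a normal field. Hence \<open>K = h\<^sub>x\<^sub>x h\<^sub>y\<^sub>y - h\<^sub>x\<^sub>y\<^sup>2\<close>
    (\<open>normal_field_derivative\<close>, \<open>lipschitz_killing_curvature_monge\<close>).

  \<^item> If \<open>P = (y, g)\<close> in the adapted coordinates, then \<open>h\<close> is \<open>g\<close> precomposed with \<open>(x, y) \<mapsto> (x, p (x, y))\<close>.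
    Since \<open>g\<close> is critical at the origin, its Hessian changes by the linear part \<open>(x, y) \<mapsto> (x, y - \<alpha> x)\<close>
    alone. That map has determinant 1, so it preserves the determinant of the Hessian, and it takes
    the direction \<open>(1, \<alpha>)\<close> of \<open>u\<close> to \<open>(1, 0)\<close>, so \<open>g\<^sub>x\<^sub>x\<close> is the Koenderink factor
    (\<open>hessian_along_fibres\<close>).

  \<^item> On the contour generator \<open>g\<^sub>x = 0\<close>, so the contour \<open>(t, g (x t, t))\<close> has slope \<open>g\<^sub>y\<close>, and its
    curvature at \<open>0\<close> is the derivative of that, \<open>g\<^sub>y\<^sub>y - g\<^sub>x\<^sub>y\<^sup>2 / g\<^sub>x\<^sub>x\<close>, the determinant of the Hessian of
    \<open>g\<close> divided by \<open>g\<^sub>x\<^sub>x\<close> (\<open>plane_curvature_contour\<close>).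

  Multiplying the last two items gives \<open>K\<close>. The curvature of the contour is defined by a description that
  speaks of some \<open>g\<close> and some \<open>x\<close>; the computation shows that all choices agree, but their existence
  has to be proved too. Both come from one smooth implicit function theorem
  (\<open>parametrized_inverse\<close>), and the second needs \<open>g\<^sub>x\<^sub>x \<noteq> 0\<close>. This is where the fold enters: if \<open>g\<^sub>x\<^sub>x = 0\<close>,
  then \<open>P\<close> would be \<open>o(t\<^sup>2)\<close> along the regular curve corresponding to the \<open>x\<close>-axis, and neither \<open>(x, y\<^sup>2)\<close>
  nor anything equivalent to it vanishes that fast along a regular curve
  (\<open>fold_singularity_no_flat_curve\<close>).\<close>


section \<open>Calculus of smooth maps\<close>

text \<open>The recursive definition speaks of \<^const>\<open>frechet_derivative\<close>, which depends on the values near a point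
  only; on an open set a function may therefore be replaced by one that agrees with it there.\<close>

lemma times_differentiable_on_cong:
  assumes "open S" "times_differentiable_on n S f" "\<forall>x\<in>S. f x = g x"
  shows "times_differentiable_on n S g"
  using assms(2,3)
proof (induction n arbitrary: f g)
  case 0
  then show ?case by (simp cong: continuous_on_cong)
next
  case (Suc n)
  have D: "(g has_derivative frechet_derivative f (at x)) (at x)" if "x \<in> S" for x
    using Suc.prems that \<open>open S\<close>
    by (auto intro!: has_derivative_transform_within_open[of f _ x UNIV S g] simp: frechet_derivative_works[symmetric])
  have "times_differentiable_on n S (\<lambda>x. frechet_derivative g (at x) v)" for v
  proof (rule Suc.IH)
    show "times_differentiable_on n S (\<lambda>x. frechet_derivative f (at x) v)"
      using Suc.prems(1) by simp
    show "\<forall>x\<in>S. frechet_derivative f (at x) v = frechet_derivative g (at x) v"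
      by (metis D frechet_derivative_at)
  qed
  with D show ?case by (auto simp: differentiable_def)
qed

text \<open>Closure properties are proved by induction on the order: differentiate by the usual rule, and
  recognize each term of the derivative as a function covered by the induction hypothesis. With this
  rule any formula for the derivative that is valid on the set will do.\<close>

lemma times_differentiable_on_SucI:
  assumes "open S" "\<And>x. x \<in> S \<Longrightarrow> (f has_derivative f' x) (at x)"
    and "\<And>v. times_differentiable_on n S (\<lambda>x. f' x v)"
  shows "times_differentiable_on (Suc n) S f"
proof -
  have "times_differentiable_on n S (\<lambda>x. frechet_derivative f (at x) v)" for v
    by (rule times_differentiable_on_cong[OF assms(1) assms(3)[of v]]) (metis assms(2) frechet_derivative_at)
  with assms(2) show ?thesis by (auto simp: differentiable_def)
qed

lemma times_differentiable_on_SucD: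
  assumes "times_differentiable_on (Suc n) S f"
  shows "times_differentiable_on n S f"
  using assms
  by (induction n arbitrary: f)
     (auto intro!: continuous_at_imp_continuous_on differentiable_imp_continuous_within)

lemma times_differentiable_on_has_derivative:
  assumes "times_differentiable_on (Suc n) S f" "x \<in> S"
  shows "(f has_derivative frechet_derivative f (at x)) (at x)"
  using assms by (simp add: frechet_derivative_works[symmetric])

lemma times_differentiable_on_subset:
  "times_differentiable_on n S f \<Longrightarrow> T \<subseteq> S \<Longrightarrow> times_differentiable_on n T f"
  by (induction n arbitrary: f) (auto intro: continuous_on_subset)

lemma times_differentiable_on_const: "times_differentiable_on n S (\<lambda>x. c)"
  by (induction n arbitrary: c) auto

lemma times_differentiable_on_bounded_linear:
  assumes "open S" "bounded_linear L" "times_differentiable_on n S f"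
  shows "times_differentiable_on n S (\<lambda>x. L (f x))"
  using assms(3)
proof (induction n arbitrary: f)
  case 0
  then show ?case using bounded_linear.continuous_on[OF assms(2)] by simp
next
  case (Suc n)
  show ?case
    using Suc.prems
    by (intro times_differentiable_on_SucI[OF assms(1), where f' = "\<lambda>x v. L (frechet_derivative f (at x) v)"]
        Suc.IH bounded_linear.has_derivative[OF assms(2)] times_differentiable_on_has_derivative) auto
qed

lemma times_differentiable_on_ident: "open S \<Longrightarrow> times_differentiable_on n S (\<lambda>x. x)"
  by (cases n) (auto intro!: times_differentiable_on_SucI times_differentiable_on_const)

lemma times_differentiable_on_add:
  assumes "open S" "times_differentiable_on n S f" "times_differentiable_on n S g"
  shows "times_differentiable_on n S (\<lambda>x. f x + g x)"
  using assms(2,3)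
proof (induction n arbitrary: f g)
  case 0
  then show ?case by (simp add: continuous_on_add)
next
  case (Suc n)
  show ?case
    using Suc.prems
    by (intro times_differentiable_on_SucI[OF assms(1), where f' = "\<lambda>x v. frechet_derivative f (at x) v + frechet_derivative g (at x) v"]
        Suc.IH has_derivative_add times_differentiable_on_has_derivative) auto
qed

lemma times_differentiable_on_sum:
  assumes "open S" "\<And>i. i \<in> I \<Longrightarrow> times_differentiable_on n S (f i)"
  shows "times_differentiable_on n S (\<lambda>x. \<Sum>i\<in>I. f i x)"
  using assms(2)
  by (induction I rule: infinite_finite_induct)
     (auto simp: times_differentiable_on_const intro!: times_differentiable_on_add[OF assms(1)])

lemma times_differentiable_on_Pair:
  assumes "open S" "times_differentiable_on n S f" "times_differentiable_on n S g"
  shows "times_differentiable_on n S (\<lambda>x. (f x, g x))"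
  using assms(2,3)
proof (induction n arbitrary: f g)
  case 0
  then show ?case by (simp add: continuous_on_Pair)
next
  case (Suc n)
  show ?case
    using Suc.prems
    by (intro times_differentiable_on_SucI[OF assms(1), where f' = "\<lambda>x v. (frechet_derivative f (at x) v, frechet_derivative g (at x) v)"]
        Suc.IH has_derivative_Pair times_differentiable_on_has_derivative) auto
qed

lemma times_differentiable_on_bounded_bilinear:
  assumes "open S" "bounded_bilinear B" "times_differentiable_on n S f" "times_differentiable_on n S g"
  shows "times_differentiable_on n S (\<lambda>x. B (f x) (g x))"
  using assms(3,4)
proof (induction n arbitrary: f g)
  case 0
  then show ?case using bounded_bilinear.continuous_on[OF assms(2)] by simp
next
  case (Suc n)
  show ?case
    using Suc.prems
    by (intro times_differentiable_on_SucI[OF assms(1), where f' = "\<lambda>x v. B (f x) (frechet_derivative g (at x) v) + B (frechet_derivative f (at x) v) (g x)"]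
        times_differentiable_on_add[OF assms(1)]
        Suc.IH bounded_bilinear.FDERIV[OF assms(2)] times_differentiable_on_has_derivative
        times_differentiable_on_SucD[OF Suc.prems(1)] times_differentiable_on_SucD[OF Suc.prems(2)]) auto
qed

lemma times_differentiable_on_inverse:
  fixes f :: "'a::real_normed_vector \<Rightarrow> real"
  assumes "open S" "times_differentiable_on n S f" "\<forall>x\<in>S. f x \<noteq> 0"
  shows "times_differentiable_on n S (\<lambda>x. inverse (f x))"
  using assms(2)
proof (induction n)
  case 0
  then show ?case using assms(3) by (simp add: continuous_on_inverse)
next
  case (Suc n)
  have IH: "times_differentiable_on n S (\<lambda>x. inverse (f x))"
    using Suc.IH times_differentiable_on_SucD[OF Suc.prems] by blast
  show ?case
    by (rule times_differentiable_on_SucI[OF assms(1)],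
       rule Deriv.has_derivative_inverse[OF _ times_differentiable_on_has_derivative[OF Suc.prems]])
     (use Suc.prems assms(3) in \<open>auto intro!: times_differentiable_on_bounded_bilinear[OF assms(1) bounded_bilinear_mult]
        times_differentiable_on_bounded_linear[OF assms(1) bounded_linear_minus[OF bounded_linear_ident]] IH\<close>)
qed

text \<open>The chain rule \<open>D (g \<circ> f) v = Dg (Df v)\<close> applies \<open>Dg\<close> to a vector that varies with the point.
  Expanding \<open>Df v\<close> in a basis turns this into a sum of products of scalars with directional
  derivatives of \<open>g\<close> in fixed directions, composed with \<open>f\<close>, to which the induction hypothesis applies.\<close>

lemma times_differentiable_on_compose:
  fixes f :: "'a::real_normed_vector \<Rightarrow> 'b::euclidean_space" and g :: "'b \<Rightarrow> 'c::real_normed_vector"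
  assumes "open S" "f ` S \<subseteq> T" "times_differentiable_on n S f" "times_differentiable_on n T g"
  shows "times_differentiable_on n S (\<lambda>x. g (f x))"
  using assms(3,4)
proof (induction n arbitrary: g)
  case 0
  then show ?case using assms(2) by (auto intro: continuous_on_compose2)
next
  case (Suc n)
  let ?Df = "\<lambda>x. frechet_derivative f (at x)" and ?Dg = "\<lambda>y. frechet_derivative g (at y)"
  have D: "((\<lambda>x. g (f x)) has_derivative (\<lambda>v. \<Sum>b\<in>Basis. (?Df x v \<bullet> b) *\<^sub>R ?Dg (f x) b)) (at x)"
    if "x \<in> S" for x
  proof -
    have g: "(g has_derivative ?Dg (f x)) (at (f x))"
      using Suc.prems(2) assms(2) that by (intro times_differentiable_on_has_derivative) auto
    have D0: "((\<lambda>x. g (f x)) has_derivative (\<lambda>v. ?Dg (f x) (?Df x v))) (at x)"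
      using diff_chain_at[OF times_differentiable_on_has_derivative[OF Suc.prems(1) that] g]
      by (simp add: o_def)
    have eq: "?Dg (f x) w = (\<Sum>b\<in>Basis. (w \<bullet> b) *\<^sub>R ?Dg (f x) b)" for w
    proof -
      have "?Dg (f x) w = ?Dg (f x) (\<Sum>b\<in>Basis. (w \<bullet> b) *\<^sub>R b)"
        by (simp add: euclidean_representation)
      also have "\<dots> = (\<Sum>b\<in>Basis. (w \<bullet> b) *\<^sub>R ?Dg (f x) b)"
        unfolding linear_sum[OF has_derivative_linear[OF g]] linear_scale[OF has_derivative_linear[OF g]] ..
      finally show ?thesis .
    qed
    show ?thesis using D0 by (rule has_derivative_eq_rhs) (rule ext, rule eq)
  qed
  show ?case
    using Suc.prems(1)[THEN times_differentiable_on_SucD] Suc.prems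
    by (intro times_differentiable_on_SucI[OF assms(1) D] times_differentiable_on_sum[OF assms(1)]
        times_differentiable_on_bounded_bilinear[OF assms(1) bounded_bilinear_scaleR] Suc.IH
        times_differentiable_on_bounded_linear[OF assms(1) bounded_linear_inner_left]) auto
qed

lemma smooth_on_compose:
  fixes f :: "'a::real_normed_vector \<Rightarrow> 'b::euclidean_space" and g :: "'b \<Rightarrow> 'c::real_normed_vector"
  shows "open S \<Longrightarrow> f ` S \<subseteq> T \<Longrightarrow> smooth_on S f \<Longrightarrow> smooth_on T g \<Longrightarrow> smooth_on S (\<lambda>x. g (f x))"
  by (simp add: smooth_on_def times_differentiable_on_compose)

lemma smooth_on_subset: "smooth_on S f \<Longrightarrow> T \<subseteq> S \<Longrightarrow> smooth_on T f"
  unfolding smooth_on_def using times_differentiable_on_subset by blast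

lemma smooth_on_has_derivative:
  "smooth_on S f \<Longrightarrow> x \<in> S \<Longrightarrow> (f has_derivative frechet_derivative f (at x)) (at x)"
  unfolding smooth_on_def using times_differentiable_on_has_derivative by blast

lemma smooth_on_continuous_on: "smooth_on S f \<Longrightarrow> continuous_on S f"
  unfolding smooth_on_def using times_differentiable_on.simps(1) by blast

lemma smooth_near_common_neighbourhood:
  assumes "smooth_near p f" "smooth_near p g"
  obtains S where "open S" "p \<in> S" "smooth_on S f" "smooth_on S g"
proof -
  obtain S T where S: "open S" "p \<in> S" "smooth_on S f" and T: "open T" "p \<in> T" "smooth_on T g"
    using assms unfolding smooth_near_def by blast
  show thesis
  proof (rule that)
    show "smooth_on (S \<inter> T) f" by (rule smooth_on_subset[OF S(3)]) simp
    show "smooth_on (S \<inter> T) g" by (rule smooth_on_subset[OF T(3)]) simp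
  qed (use S T in auto)
qed

lemma smooth_near_compose:
  fixes f :: "'a::real_normed_vector \<Rightarrow> 'b::euclidean_space" and g :: "'b \<Rightarrow> 'c::real_normed_vector"
  assumes "smooth_near p f" "smooth_near (f p) g"
  shows "smooth_near p (\<lambda>x. g (f x))"
proof -
  obtain S T where S: "open S" "p \<in> S" "smooth_on S f" and T: "open T" "f p \<in> T" "smooth_on T g"
    using assms unfolding smooth_near_def by blast
  have "open (S \<inter> f -` T)"
    using continuous_open_preimage[OF smooth_on_continuous_on[OF S(3)] S(1) T(1)] .
  moreover have "smooth_on (S \<inter> f -` T) (\<lambda>x. g (f x))"
    using calculation by (rule smooth_on_compose[OF _ _ smooth_on_subset[OF S(3)] T(3)]) auto
  ultimately show ?thesis
    unfolding smooth_near_def using S(2) T(2) by (intro exI[of _ "S \<inter> f -` T"]) simp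
qed

lemma smooth_near_Pair:
  assumes "smooth_near p f" "smooth_near p g"
  shows "smooth_near p (\<lambda>x. (f x, g x))"
proof -
  obtain S where "open S" "p \<in> S" "smooth_on S f" "smooth_on S g"
    using smooth_near_common_neighbourhood[OF assms] .
  then show ?thesis unfolding smooth_near_def smooth_on_def
    by (intro exI[of _ S]) (simp add: times_differentiable_on_Pair)
qed

lemma smooth_near_bounded_linear: 
  assumes "bounded_linear L" shows "smooth_near p L"
  unfolding smooth_near_def smooth_on_def
  by (intro exI[of _ UNIV]) (auto intro!: times_differentiable_on_bounded_linear[OF _ assms] times_differentiable_on_ident)

lemma smooth_near_add:
  assumes "smooth_near p f" "smooth_near p g"
  shows "smooth_near p (\<lambda>x. f x + g x)"
proof -
  obtain S where "open S" "p \<in> S" "smooth_on S f" "smooth_on S g"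
    using smooth_near_common_neighbourhood[OF assms] .
  then show ?thesis unfolding smooth_near_def smooth_on_def
    by (intro exI[of _ S]) (simp add: times_differentiable_on_add)
qed

lemma smooth_near_mult:
  fixes f g :: "'a::real_normed_vector \<Rightarrow> real"
  assumes "smooth_near p f" "smooth_near p g"
  shows "smooth_near p (\<lambda>x. f x * g x)"
proof -
  obtain S where "open S" "p \<in> S" "smooth_on S f" "smooth_on S g"
    using smooth_near_common_neighbourhood[OF assms] .
  then show ?thesis unfolding smooth_near_def smooth_on_def
    by (intro exI[of _ S]) (simp add: times_differentiable_on_bounded_bilinear[OF _ bounded_bilinear_mult])
qed

lemma smooth_near_lincomb:
  fixes f g :: "'a::real_normed_vector \<Rightarrow> real"
  assumes "smooth_near p f" "smooth_near p g"
  shows "smooth_near p (\<lambda>x. a * f x + b * g x)"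
proof -
  have const: "smooth_near p (\<lambda>_. c)" for c :: real
    unfolding smooth_near_def smooth_on_def by (intro exI[of _ UNIV]) (simp add: times_differentiable_on_const)
  show ?thesis by (intro smooth_near_add smooth_near_mult const assms)
qed

lemma smooth_near_has_derivative:
  "smooth_near p f \<Longrightarrow> (f has_derivative frechet_derivative f (at p)) (at p)"
  unfolding smooth_near_def using smooth_on_has_derivative by blast

lemma eventually_smooth_near:
  "smooth_near p f \<Longrightarrow> \<forall>\<^sub>F q in nhds p. smooth_near q f"
  unfolding smooth_near_def eventually_nhds by blast

lemma smooth_near_isCont: "smooth_near p f \<Longrightarrow> isCont f p"
  using has_derivative_continuous smooth_near_has_derivative by blast

lemma isCont_tendsto_nhds: "isCont f x \<Longrightarrow> (f \<longlongrightarrow> f x) (nhds x)"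
  unfolding isCont_def tendsto_at_iff_tendsto_nhds .

lemma smooth_near_tendsto: "smooth_near p f \<Longrightarrow> (f \<longlongrightarrow> f p) (nhds p)"
  by (intro isCont_tendsto_nhds smooth_near_isCont)

lemma smooth_near_real_DERIV:
  fixes f :: "real \<Rightarrow> real"
  shows "smooth_near t f \<Longrightarrow> (f has_field_derivative deriv f t) (at t)"
  using smooth_near_has_derivative DERIV_deriv_iff_real_differentiable differentiable_def by blast


section \<open>Partial derivatives of functions of two variables\<close>

text \<open>Partial derivatives are defined by freezing one variable, so they are the values of the total
  derivative on the two basis vectors.\<close>

lemma has_derivative_pd:
  assumes "(f has_derivative f') (at q)"
  shows "pd1 f q = f' (1, 0)" "pd2 f q = f' (0, 1)"
proof -
  obtain x y where q: "q = (x, y)" by force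
  have lin: "linear f'" using assms has_derivative_linear by blast
  have "((\<lambda>s. f (s, y)) has_derivative (\<lambda>s. f' (s, 0))) (at x)"
    by (rule has_derivative_compose[OF has_derivative_Pair[OF has_derivative_ident has_derivative_const]])
       (use assms q in simp)
  moreover have "(\<lambda>s. f' (s, 0)) = (*) (f' (1, 0))"
  proof
    show "f' (s, 0) = f' (1, 0) * s" for s
      using linear_scale[OF lin, of s "(1, 0)"] by simp
  qed
  ultimately have "((\<lambda>s. f (s, y)) has_field_derivative f' (1, 0)) (at x)"
    by (simp add: has_field_derivative_def)
  then show "pd1 f q = f' (1, 0)" by (simp add: pd1_def q DERIV_imp_deriv)
  have "((\<lambda>s. f (x, s)) has_derivative (\<lambda>s. f' (0, s))) (at y)"
    by (rule has_derivative_compose[OF has_derivative_Pair[OF has_derivative_const has_derivative_ident]])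
       (use assms q in simp)
  moreover have "(\<lambda>s. f' (0, s)) = (*) (f' (0, 1))"
  proof
    show "f' (0, s) = f' (0, 1) * s" for s
      using linear_scale[OF lin, of s "(0, 1)"] by simp
  qed
  ultimately have "((\<lambda>s. f (x, s)) has_field_derivative f' (0, 1)) (at y)"
    by (simp add: has_field_derivative_def)
  then show "pd2 f q = f' (0, 1)" by (simp add: pd2_def q DERIV_imp_deriv)
qed

lemma has_derivative_by_partials:
  assumes "f differentiable (at q)"
  shows "(f has_derivative (\<lambda>v. pd1 f q * fst v + pd2 f q * snd v)) (at q)"
proof -
  obtain f' where f': "(f has_derivative f') (at q)" using assms by (auto simp: differentiable_def)
  have lin: "linear f'" using f' has_derivative_linear by blast
  have "f' v = pd1 f q * fst v + pd2 f q * snd v" for v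
  proof -
    have "f' v = f' (fst v *\<^sub>R (1, 0) + snd v *\<^sub>R (0, 1))" by simp
    also have "\<dots> = fst v *\<^sub>R f' (1, 0) + snd v *\<^sub>R f' (0, 1)"
      unfolding linear_add[OF lin] linear_scale[OF lin] ..
    finally show ?thesis using has_derivative_pd[OF f'] by simp
  qed
  then show ?thesis by (intro has_derivative_eq_rhs[OF f'] ext)
qed

lemma smooth_near_pd:
  assumes "smooth_near p f"
  shows "(f has_derivative (\<lambda>v. pd1 f p * fst v + pd2 f p * snd v)) (at p)"
  by (rule has_derivative_by_partials) (use smooth_near_has_derivative[OF assms] in \<open>auto simp: differentiable_def\<close>)

lemma smooth_on_partials:
  assumes "open S" "smooth_on S f"
  shows "smooth_on S (pd1 f)" "smooth_on S (pd2 f)"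
proof -
  have "times_differentiable_on n S (\<lambda>x. frechet_derivative f (at x) v)" for n v
    using assms(2) times_differentiable_on.simps(2)[of n S f] unfolding smooth_on_def by blast
  moreover have "\<forall>x\<in>S. frechet_derivative f (at x) (1, 0) = pd1 f x"
    "\<forall>x\<in>S. frechet_derivative f (at x) (0, 1) = pd2 f x"
    by (simp_all add: has_derivative_pd[OF smooth_on_has_derivative[OF assms(2)]])
  ultimately show "smooth_on S (pd1 f)" "smooth_on S (pd2 f)"
    unfolding smooth_on_def using times_differentiable_on_cong[OF assms(1)] by blast+
qed

text \<open>Together with \<open>smooth_near_pd\<close> this replaces the recursive definition of smoothness in the plane:
  a smooth germ is differentiable, and its partial derivatives are smooth germs again.\<close>

lemma smooth_near_partials:
  assumes "smooth_near p f"
  shows "smooth_near p (pd1 f)" "smooth_near p (pd2 f)"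
  using assms smooth_on_partials unfolding smooth_near_def by blast+

lemma smooth_near_DERIV:
  assumes "smooth_near (x, y) f"
  shows "((\<lambda>s. f (s, y)) has_field_derivative pd1 f (x, y)) (at x)"
    and "((\<lambda>s. f (x, s)) has_field_derivative pd2 f (x, y)) (at y)"
proof -
  have "((\<lambda>s. (s, y)) has_derivative (\<lambda>s. (s, 0))) (at x)"
    by (intro has_derivative_Pair has_derivative_ident has_derivative_const)
  from has_derivative_compose[OF this smooth_near_pd[OF assms]]
  show "((\<lambda>s. f (s, y)) has_field_derivative pd1 f (x, y)) (at x)"
    by (simp add: has_field_derivative_def)
  have "((\<lambda>s. (x, s)) has_derivative (\<lambda>s. (0, s))) (at y)"
    by (intro has_derivative_Pair has_derivative_ident has_derivative_const)
  from has_derivative_compose[OF this smooth_near_pd[OF assms]]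
  show "((\<lambda>s. f (x, s)) has_field_derivative pd2 f (x, y)) (at y)"
    by (simp add: has_field_derivative_def)
qed

lemma eventually_pd_cong:
  assumes "\<forall>\<^sub>F q in nhds p. f q = g q"
  shows "\<forall>\<^sub>F q in nhds p. pd1 f q = pd1 g q" "\<forall>\<^sub>F q in nhds p. pd2 f q = pd2 g q"
proof -
  have 1: "pd1 f q = pd1 g q \<and> pd2 f q = pd2 g q" if "\<forall>\<^sub>F z in nhds q. f z = g z" for q
  proof -
    obtain x y where q: "q = (x, y)" by force
    have "((\<lambda>s. (s, y)) \<longlongrightarrow> (x, y)) (nhds x)" "((\<lambda>s. (x, s)) \<longlongrightarrow> (x, y)) (nhds y)"
      by (auto intro!: tendsto_Pair filterlim_ident tendsto_const)
    then have "\<forall>\<^sub>F s in nhds x. f (s, y) = g (s, y)" "\<forall>\<^sub>F s in nhds y. f (x, s) = g (x, s)"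
      using that unfolding q by (auto dest: eventually_compose_filterlim)
    then show ?thesis by (auto simp: pd1_def pd2_def q intro: deriv_cong_ev)
  qed
  have "\<forall>\<^sub>F q in nhds p. \<forall>\<^sub>F z in nhds q. f z = g z"
    using assms by (simp add: eventually_eventually)
  then show "\<forall>\<^sub>F q in nhds p. pd1 f q = pd1 g q" "\<forall>\<^sub>F q in nhds p. pd2 f q = pd2 g q"
    using 1 by (auto elim: eventually_mono)
qed

lemma eventually_pd_eqD:
  assumes "\<forall>\<^sub>F q in nhds p. f q = g q"
  shows "pd1 f p = pd1 g p" "pd2 f p = pd2 g p"
  using eventually_pd_cong[OF assms] by (auto dest: eventually_nhds_x_imp_x)

lemma pd_add:
  assumes "smooth_near q f" "smooth_near q g"
  shows "pd1 (\<lambda>q. f q + g q) q = pd1 f q + pd1 g q" "pd2 (\<lambda>q. f q + g q) q = pd2 f q + pd2 g q"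
  using has_derivative_pd[OF has_derivative_add[OF smooth_near_pd[OF assms(1)] smooth_near_pd[OF assms(2)]]]
  by simp_all

lemma pd_mult:
  assumes "smooth_near q f" "smooth_near q g"
  shows "pd1 (\<lambda>q. f q * g q) q = f q * pd1 g q + pd1 f q * g q"
    "pd2 (\<lambda>q. f q * g q) q = f q * pd2 g q + pd2 f q * g q"
  using has_derivative_pd[OF has_derivative_mult[OF smooth_near_pd[OF assms(1)] smooth_near_pd[OF assms(2)]]]
  by simp_all

lemma pd_lincomb:
  assumes "smooth_near q f" "smooth_near q g"
  shows "pd1 (\<lambda>q. a * f q + b * g q) q = a * pd1 f q + b * pd1 g q"
    and "pd2 (\<lambda>q. a * f q + b * g q) q = a * pd2 f q + b * pd2 g q"
  using has_derivative_pd[OF has_derivative_add[OF has_derivative_mult_right[OF smooth_near_pd[OF assms(1)], of a]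
      has_derivative_mult_right[OF smooth_near_pd[OF assms(2)], of b]]]
  by simp_all

lemma second_pd_lincomb:
  assumes f: "smooth_near q f" and g: "smooth_near q g"
  shows "pd1 (pd1 (\<lambda>q. a * f q + b * g q)) q = a * pd1 (pd1 f) q + b * pd1 (pd1 g) q"
    and "pd2 (pd1 (\<lambda>q. a * f q + b * g q)) q = a * pd2 (pd1 f) q + b * pd2 (pd1 g) q"
    and "pd2 (pd2 (\<lambda>q. a * f q + b * g q)) q = a * pd2 (pd2 f) q + b * pd2 (pd2 g) q"
proof -
  have 1: "\<forall>\<^sub>F z in nhds q. pd1 (\<lambda>q. a * f q + b * g q) z = a * pd1 f z + b * pd1 g z"
    and 2: "\<forall>\<^sub>F z in nhds q. pd2 (\<lambda>q. a * f q + b * g q) z = a * pd2 f z + b * pd2 g z"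
    using eventually_smooth_near[OF f] eventually_smooth_near[OF g]
    by (eventually_elim, simp add: pd_lincomb)+
  show "pd1 (pd1 (\<lambda>q. a * f q + b * g q)) q = a * pd1 (pd1 f) q + b * pd1 (pd1 g) q"
    "pd2 (pd1 (\<lambda>q. a * f q + b * g q)) q = a * pd2 (pd1 f) q + b * pd2 (pd1 g) q"
    "pd2 (pd2 (\<lambda>q. a * f q + b * g q)) q = a * pd2 (pd2 f) q + b * pd2 (pd2 g) q"
    using eventually_pd_eqD[OF 1] eventually_pd_eqD[OF 2]
    by (simp_all add: pd_lincomb smooth_near_partials f g)
qed

text \<open>The mean value theorem twice: first for \<open>s \<mapsto> f (s, b + t) - f (s, b)\<close>, then for the first partial
  derivative in its second argument. Only the right-hand side distinguishes the two variables,
  which is what yields the symmetry of second derivatives below.\<close>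

lemma second_difference_mean_value:
  fixes f :: "real \<times> real \<Rightarrow> real"
  assumes "t > 0"
    and D1: "\<And>x y. x \<in> {a..a+t} \<Longrightarrow> y \<in> {b..b+t} \<Longrightarrow>
      ((\<lambda>s. f (s, y)) has_field_derivative pd1 f (x, y)) (at x)"
    and D2: "\<And>x y. x \<in> {a..a+t} \<Longrightarrow> y \<in> {b..b+t} \<Longrightarrow>
      ((\<lambda>s. pd1 f (x, s)) has_field_derivative pd2 (pd1 f) (x, y)) (at y)"
  obtains x y where "x \<in> {a..a+t}" "y \<in> {b..b+t}"
    "f (a+t, b+t) - f (a+t, b) - f (a, b+t) + f (a, b) = t\<^sup>2 * pd2 (pd1 f) (x, y)"
proof -
  have "\<exists>z>a. z < a+t \<and> (f (a+t, b+t) - f (a+t, b)) - (f (a, b+t) - f (a, b))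
      = (a+t-a) * (pd1 f (z, b+t) - pd1 f (z, b))"
    using \<open>t > 0\<close> by (intro MVT2 DERIV_diff D1) auto
  then obtain x where "a < x" "x < a+t" and fx: "(f (a+t, b+t) - f (a+t, b)) - (f (a, b+t) - f (a, b))
      = (a+t-a) * (pd1 f (x, b+t) - pd1 f (x, b))" by blast
  then have x: "x \<in> {a..a+t}" by simp
  have "\<exists>z>b. z < b+t \<and> pd1 f (x, b+t) - pd1 f (x, b) = (b+t-b) * pd2 (pd1 f) (x, z)"
    using \<open>t > 0\<close> x by (intro MVT2 D2) auto
  then obtain y where "b < y" "y < b+t" and fy: "pd1 f (x, b+t) - pd1 f (x, b) = (b+t-b) * pd2 (pd1 f) (x, y)"
    by blast
  then have y: "y \<in> {b..b+t}" by simp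
  show thesis
    by (rule that[OF x y]) (use fx fy in \<open>simp add: power2_eq_square\<close>)
qed

text \<open>The second difference of \<open>f\<close> over a small square at \<open>p\<close> is symmetric under exchanging the variables.
  So each of the two mixed derivatives takes the same value somewhere in the square, and by
  continuity they cannot differ at \<open>p\<close>.\<close>

lemma mixed_partials_commute:
  assumes "smooth_near p f"
  shows "pd1 (pd2 f) p = pd2 (pd1 f) p"
proof (rule ccontr)
  define A where "A = pd2 (pd1 f)"
  define B where "B = pd1 (pd2 f)"
  define e where "e = dist (A p) (B p) / 2"
  assume "pd1 (pd2 f) p \<noteq> pd2 (pd1 f) p"
  then have "e > 0" by (simp add: A_def B_def e_def)
  obtain a b where p: "p = (a, b)" by force
  have "(A \<longlongrightarrow> A p) (nhds p)" "(B \<longlongrightarrow> B p) (nhds p)"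
    unfolding A_def B_def by (intro smooth_near_tendsto smooth_near_partials assms)+
  then have "\<forall>\<^sub>F q in nhds p. dist (A q) (A p) < e" "\<forall>\<^sub>F q in nhds p. dist (B q) (B p) < e"
    using \<open>e > 0\<close> by (auto intro: tendstoD)
  then have "\<forall>\<^sub>F q in nhds p. dist (A q) (A p) < e \<and> dist (B q) (B p) < e \<and> smooth_near q f"
    using eventually_smooth_near[OF assms] by eventually_elim auto
  then obtain d where "d > 0" and d: "\<And>q. dist q p < d \<Longrightarrow>
      dist (A q) (A p) < e \<and> dist (B q) (B p) < e \<and> smooth_near q f"
    by (auto simp: eventually_nhds_metric)
  \<comment> \<open>A square of side \<open>d / 3\<close> with corner \<open>p\<close> lies in the ball of radius \<open>d\<close>.\<close>
  define t where "t = d / 3"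
  have "t > 0" using \<open>d > 0\<close> by (simp add: t_def)
  have box: "dist (x, y) p < d" if "x \<in> {a..a+t}" "y \<in> {b..b+t}" for x y
  proof -
    have "dist (x, y) p \<le> dist x a + dist y b"
      by (simp add: p dist_Pair_Pair real_sqrt_sum_squares_triangle_ineq sqrt_sum_squares_le_sum)
    also have "\<dots> < d" using that \<open>d > 0\<close> by (auto simp: dist_real_def t_def)
    finally show ?thesis .
  qed
  obtain x y where xy: "x \<in> {a..a+t}" "y \<in> {b..b+t}"
    "f (a+t, b+t) - f (a+t, b) - f (a, b+t) + f (a, b) = t\<^sup>2 * A (x, y)"
    unfolding A_def
    by (rule second_difference_mean_value[OF \<open>t > 0\<close>, of a b f])
       (auto intro!: smooth_near_DERIV smooth_near_partials simp: box d)
  \<comment> \<open>The same square for \<open>f\<close> with its variables exchanged.\<close>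
  let ?s = "\<lambda>(x, y). f (y, x)"
  have s: "pd1 ?s = (\<lambda>(x, y). pd2 f (y, x))" "pd2 (\<lambda>(x, y). pd2 f (y, x)) = (\<lambda>(x, y). B (y, x))"
    by (auto simp: pd1_def pd2_def B_def fun_eq_iff)
  obtain y' x' where xy': "x' \<in> {a..a+t}" "y' \<in> {b..b+t}"
    "f (a+t, b+t) - f (a, b+t) - f (a+t, b) + f (a, b) = t\<^sup>2 * B (x', y')"
    by (rule second_difference_mean_value[OF \<open>t > 0\<close>, of b a ?s])
       (auto intro!: smooth_near_DERIV smooth_near_partials simp: box d s, auto intro!: smooth_near_DERIV smooth_near_partials simp: box d B_def)
  have "t\<^sup>2 * A (x, y) = t\<^sup>2 * B (x', y')" using xy(3) xy'(3) by linarith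
  then have "A (x, y) = B (x', y')" using \<open>t > 0\<close> by simp
  moreover have "dist (A (x, y)) (A p) < e" "dist (B (x', y')) (B p) < e"
    using d box xy xy' by blast+
  ultimately show False
    using dist_triangle3[of "A p" "B p" "A (x, y)"] by (simp add: e_def)
qed


section \<open>Solving an equation for the second coordinate\<close>

text \<open>Near the origin \<open>F (x, y) = z\<close> has the unique solution \<open>y = G (x, z)\<close>. The inverse function theorem
  for \<open>(x, y) \<mapsto> (x, F (x, y))\<close> provides a differentiable inverse \<open>\<Phi>\<close>. It is smooth because its
  derivative is a rational expression in the partial derivatives of \<open>F\<close> at \<open>\<Phi> z\<close>: if \<open>\<Phi>\<close> is \<open>n\<close> times
  differentiable, then so is its derivative.\<close>

lemma parametrized_inverse:
  assumes smooth: "smooth_near 0 F" and F0: "F 0 = 0" "pd2 F 0 \<noteq> 0"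
  obtains G where "smooth_near 0 G" "G 0 = 0"
    "\<forall>\<^sub>F (x, y) in nhds 0. G (x, F (x, y)) = y" "\<forall>\<^sub>F (x, z) in nhds 0. F (x, G (x, z)) = z"
proof -
  have "(pd2 F \<longlongrightarrow> pd2 F 0) (nhds 0)"
    by (intro smooth_near_tendsto smooth_near_partials smooth)
  then have "\<forall>\<^sub>F q in nhds 0. pd2 F q \<noteq> 0"
    using eventually_compose_filterlim[OF t1_space_nhds[OF F0(2)]] by blast
  then obtain S1 where S1: "open S1" "0 \<in> S1" "\<And>q. q \<in> S1 \<Longrightarrow> pd2 F q \<noteq> 0"
    unfolding eventually_nhds by blast
  obtain S2 where S2: "open S2" "0 \<in> S2" "smooth_on S2 F"
    using smooth unfolding smooth_near_def by blast
  define S where "S = S1 \<inter> S2"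
  have SF: "smooth_on S F" unfolding S_def by (rule smooth_on_subset[OF S2(3)]) simp
  have S: "open S" "0 \<in> S" "\<And>q. q \<in> S \<Longrightarrow> smooth_near q F" "\<And>q. q \<in> S \<Longrightarrow> pd2 F q \<noteq> 0"
    using S1 S2 unfolding S_def smooth_near_def by blast+
  \<comment> \<open>\<open>L q\<close> is the derivative of \<open>(x, y) \<mapsto> (x, F (x, y))\<close> at \<open>q\<close>, and \<open>K q\<close> below its inverse.\<close>
  define L where "L q v = (fst v, pd1 F q * fst v + pd2 F q * snd v)" for q v :: "real \<times> real"
  have bl: "bounded_linear (L q)" for q
    unfolding L_def by (intro bounded_linear_intros)
  have der: "((\<lambda>q. (fst q, F q)) has_derivative blinfun_apply (Blinfun (L q))) (at q)" if "q \<in> S" for q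
    unfolding bounded_linear_Blinfun_apply[OF bl] unfolding L_def
    by (intro has_derivative_Pair has_derivative_fst has_derivative_ident smooth_near_pd S that)
  have "continuous_on S (pd1 F)" "continuous_on S (pd2 F)"
    using S(3) by (auto intro!: continuous_at_imp_continuous_on smooth_near_isCont smooth_near_partials)
  then have cont: "continuous_on S (\<lambda>q. Blinfun (L q))"
    by (intro continuous_on_blinfun_componentwise)
       (auto simp: bounded_linear_Blinfun_apply[OF bl] L_def intro!: continuous_intros)
  define K where "K q v = (fst v, (snd v + (- fst v) * pd1 F q) * inverse (pd2 F q))" for q v :: "real \<times> real"
  have blK: "bounded_linear (K q)" for q
    unfolding K_def by (intro bounded_linear_intros bounded_linear_minus)
  have KL: "K q (L q v) = v" "L q (K q v) = v" if "q \<in> S" for q v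
    using S(4)[OF that] by (simp_all add: K_def L_def field_simps)
  have inv: "Blinfun (K 0) o\<^sub>L Blinfun (L 0) = id_blinfun"
    using KL(1)[OF S(2)] by (intro blinfun_eqI) (simp add: bounded_linear_Blinfun_apply[OF bl] bounded_linear_Blinfun_apply[OF blK])
  obtain U V \<Phi> \<Phi>' where UV: "open U" "U \<subseteq> S" "0 \<in> U" "open V" "(fst (0::real \<times> real), F 0) \<in> V"
    and hom: "homeomorphism U V (\<lambda>q. (fst q, F q)) \<Phi>"
    and der\<Phi>: "\<And>z. z \<in> V \<Longrightarrow> (\<Phi> has_derivative \<Phi>' z) (at z)"
    and inv\<Phi>: "\<And>z. z \<in> V \<Longrightarrow> \<Phi>' z = inv (blinfun_apply (Blinfun (L (\<Phi> z))))"
    and "\<And>z. z \<in> V \<Longrightarrow> bij (blinfun_apply (Blinfun (L (\<Phi> z))))"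
    by (rule inverse_function_theorem[OF S(1) der cont S(2) inv]) blast+
  have V0: "0 \<in> V" using UV(5) F0 by (simp add: zero_prod_def)
  have \<Phi>V: "\<Phi> z \<in> S" "fst (\<Phi> z) = fst z" "F (\<Phi> z) = snd z" if "z \<in> V" for z
  proof -
    have "\<Phi> z \<in> U" "(fst (\<Phi> z), F (\<Phi> z)) = z"
      using hom that unfolding homeomorphism_def by blast+
    then show "\<Phi> z \<in> S" "fst (\<Phi> z) = fst z" "F (\<Phi> z) = snd z"
      using UV(2) by (auto simp: prod_eq_iff)
  qed
  have \<Phi>': "(\<Phi> has_derivative K (\<Phi> z)) (at z)" if "z \<in> V" for z
  proof -
    have "\<Phi>' z = K (\<Phi> z)"
      unfolding inv\<Phi>[OF that] bounded_linear_Blinfun_apply[OF bl]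
      using KL[OF \<Phi>V(1)[OF that]] by (intro inv_equality) auto
    with der\<Phi>[OF that] show ?thesis by simp
  qed
  have td: "times_differentiable_on n V \<Phi>" for n
  proof (induction n)
    case 0
    then show ?case by (auto intro!: continuous_at_imp_continuous_on has_derivative_continuous[OF \<Phi>'])
  next
    case (Suc n)
    have SV: "\<Phi> ` V \<subseteq> S" using \<Phi>V(1) by blast
    have pd1: "times_differentiable_on n V (\<lambda>z. pd1 F (\<Phi> z))"
      using times_differentiable_on_compose[OF UV(4) SV Suc.IH] smooth_on_partials(1)[OF S(1) SF]
      unfolding smooth_on_def by blast
    have pd2: "times_differentiable_on n V (\<lambda>z. pd2 F (\<Phi> z))"
      using times_differentiable_on_compose[OF UV(4) SV Suc.IH] smooth_on_partials(2)[OF S(1) SF]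
      unfolding smooth_on_def by blast
    have "times_differentiable_on n V (\<lambda>z. K (\<Phi> z) v)" for v
      unfolding K_def using S(4)[OF \<Phi>V(1)]
      by (intro times_differentiable_on_Pair times_differentiable_on_bounded_bilinear[OF _ bounded_bilinear_mult]
          times_differentiable_on_add times_differentiable_on_inverse times_differentiable_on_const UV(4) pd1 pd2) auto
    with \<Phi>' show ?case by (rule times_differentiable_on_SucI[OF UV(4)])
  qed
  define G where "G z = snd (\<Phi> z)" for z
  have FG: "F (fst z, G z) = snd z" if "z \<in> V" for z
    using \<Phi>V[OF that] by (metis G_def prod.collapse)
  have GF: "G (fst q, F q) = snd q" if "q \<in> U" for q
    using hom that by (auto simp: G_def homeomorphism_def)
  show thesis
  proof (rule that)
    show "smooth_near 0 G"
      unfolding smooth_near_def smooth_on_def G_def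
      using UV(4) V0 times_differentiable_on_bounded_linear[OF UV(4) bounded_linear_snd td] by blast
    show "G 0 = 0" using GF[OF UV(3)] F0 by (simp add: zero_prod_def)
    show "\<forall>\<^sub>F (x, y) in nhds 0. G (x, F (x, y)) = y"
      using GF UV unfolding eventually_nhds by (intro exI[of _ U]) auto
    show "\<forall>\<^sub>F (x, z) in nhds 0. F (x, G (x, z)) = z"
      using FG UV V0 unfolding eventually_nhds by (intro exI[of _ V]) auto
  qed
qed


section \<open>Curves through a fold point\<close>

lemma lipschitz_at_zero_of_has_derivative:
  assumes "(f has_derivative D) (at 0)" "f 0 = 0"
  obtains K where "\<forall>\<^sub>F z in nhds 0. norm (f z) \<le> norm z * K"
proof -
  obtain B where B: "\<And>z. norm (D z) \<le> norm z * B"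
    using has_derivative_bounded_linear[OF assms(1)] bounded_linear.bounded by blast
  obtain d where "d > 0" and d: "\<And>z. norm z < d \<Longrightarrow> norm (f z - D z) \<le> norm z"
    using assms unfolding has_derivative_at_alt by (auto dest!: spec[of _ 1])
  have "norm (f z) \<le> norm z * (1 + B)" if "norm z < d" for z
    using norm_triangle_ineq[of "f z - D z" "D z"] d[OF that] B[of z] by (simp add: algebra_simps)
  with \<open>d > 0\<close> show thesis
    by (intro that[of "1 + B"]) (auto simp: eventually_nhds_metric)
qed

text \<open>A fold vanishes to second order at most along a regular curve. In the normal form this is clear: if
  both \<open>d\<^sub>1\<close> and \<open>d\<^sub>2\<^sup>2\<close> are \<open>o(t\<^sup>2)\<close>, then \<open>d\<^sub>1\<close> and \<open>d\<^sub>2\<close> are \<open>o(t)\<close>, so the curve \<open>d\<close> has velocity 0. A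
  diffeomorphism of the target preserves the order of vanishing, and one of the source preserves
  regular curves, so the property passes to everything equivalent to the normal form. The factor
  \<open>inverse (t\<^sup>2)\<close> in the statement expresses that \<open>P (c t)\<close> is \<open>o(t\<^sup>2)\<close>.\<close>

lemma fold_singularity_no_flat_curve:
  assumes fold: "fold_singularity P"
    and c: "(c has_vector_derivative v) (at 0)" "c 0 = 0" "v \<noteq> 0"
  shows "\<not> ((\<lambda>t. inverse (t\<^sup>2) *\<^sub>R P (c t)) \<longlongrightarrow> 0) (at 0)"
proof
  assume flat: "((\<lambda>t. inverse (t\<^sup>2) *\<^sub>R P (c t)) \<longlongrightarrow> 0) (at 0)"
  obtain \<phi> \<psi> where \<phi>: "diffeo_germ \<phi>" and \<psi>: "diffeo_germ \<psi>"
    and eq: "\<forall>\<^sub>F q in nhds 0. \<psi> (P q) = (\<lambda>(x, y). (x, y\<^sup>2)) (\<phi> q)"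
    using fold unfolding fold_singularity_def A_equivalent_def by blast
  obtain U V \<phi>' where U: "open U" "0 \<in> U" "open V" "homeomorphism U V \<phi> \<phi>'" "smooth_on V \<phi>'"
    using \<phi> unfolding diffeo_germ_def by blast
  have \<phi>0: "\<phi> 0 = 0" using \<phi> unfolding diffeo_germ_def by blast
  obtain D\<psi> where D\<psi>: "(\<psi> has_derivative D\<psi>) (at 0)" "\<psi> 0 = 0"
    using \<psi> smooth_on_has_derivative unfolding diffeo_germ_def by blast
  obtain K where K: "\<forall>\<^sub>F z in nhds 0. norm (\<psi> z) \<le> norm z * K"
    using lipschitz_at_zero_of_has_derivative[OF D\<psi>] by blast
  have "isCont c 0"
    using c(1) has_vector_derivative_continuous by blast
  then have c_lim: "(c \<longlongrightarrow> 0) (at 0)" using c(2) by (simp add: isCont_def)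
  have "((\<lambda>t. t\<^sup>2 *\<^sub>R (inverse (t\<^sup>2) *\<^sub>R P (c t))) \<longlongrightarrow> 0) (at 0)"
    by (rule tendsto_eq_rhs[OF tendsto_scaleR[OF tendsto_power[OF tendsto_ident_at] flat]]) simp
  then have "((\<lambda>t. P (c t)) \<longlongrightarrow> 0) (at 0)"
    by (rule Lim_transform_eventually) (auto simp: eventually_at_filter)
  then have "\<forall>\<^sub>F t in at 0. norm (\<psi> (P (c t))) \<le> norm (P (c t)) * K"
    using eventually_compose_filterlim[OF K] by blast
  moreover define d where "d t = \<phi> (c t)" for t
  have "\<forall>\<^sub>F t in at 0. \<psi> (P (c t)) = (\<lambda>(x, y). (x, y\<^sup>2)) (d t)"
    using eventually_compose_filterlim[OF eq c_lim] by (simp add: d_def)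
  ultimately have "\<forall>\<^sub>F t in at 0. norm (inverse (t\<^sup>2) *\<^sub>R (fst (d t), (snd (d t))\<^sup>2))
      \<le> norm (inverse (t\<^sup>2) *\<^sub>R P (c t)) * K"
  proof eventually_elim
    case (elim t)
    then have "norm (fst (d t), (snd (d t))\<^sup>2) \<le> norm (P (c t)) * K" by (simp add: case_prod_beta)
    then have "inverse (t\<^sup>2) * norm (fst (d t), (snd (d t))\<^sup>2) \<le> inverse (t\<^sup>2) * (norm (P (c t)) * K)"
      by (rule mult_left_mono) simp
    then show ?case unfolding norm_scaleR by simp
  qed
  \<comment> \<open>The flatness of \<open>P\<close> along \<open>c\<close> has become that of the normal form along the transported curve \<open>d\<close>.\<close>
  then have lim: "((\<lambda>t. inverse (t\<^sup>2) *\<^sub>R (fst (d t), (snd (d t))\<^sup>2)) \<longlongrightarrow> 0) (at 0)"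
    by (rule tendsto_0_le[OF flat])
  have d0: "d 0 = 0" by (simp add: d_def c \<phi>0)
  have "((\<lambda>t. inverse (t\<^sup>2) * fst (d t)) \<longlongrightarrow> 0) (at 0)"
    using tendsto_fst[OF lim] by simp
  from tendsto_mult[OF tendsto_ident_at this]
  have "((\<lambda>t. t * (inverse (t\<^sup>2) * fst (d t))) \<longlongrightarrow> 0) (at 0)" by simp
  then have "((\<lambda>t. fst (d t) / t) \<longlongrightarrow> 0) (at 0)"
    by (rule Lim_transform_eventually) (auto simp: eventually_at_filter power2_eq_square field_simps intro!: always_eventually)
  then have "((\<lambda>t. fst (d t)) has_field_derivative 0) (at 0)"
    using d0 by (simp add: has_field_derivative_iff)
  moreover
  have "((\<lambda>t. sqrt (inverse (t\<^sup>2) * (snd (d t))\<^sup>2)) \<longlongrightarrow> sqrt 0) (at 0)"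
    using tendsto_snd[OF lim] by (intro tendsto_real_sqrt) simp
  then have "((\<lambda>t. \<bar>snd (d t) / t\<bar>) \<longlongrightarrow> 0) (at 0)"
    by (simp add: real_sqrt_mult real_sqrt_inverse divide_inverse abs_mult mult.commute)
  then have "((\<lambda>t. snd (d t) / t) \<longlongrightarrow> 0) (at 0)"
    by (rule tendsto_rabs_zero_cancel)
  then have "((\<lambda>t. snd (d t)) has_field_derivative 0) (at 0)"
    using d0 by (simp add: has_field_derivative_iff)
  ultimately have "((\<lambda>t. (fst (d t), snd (d t))) has_derivative (\<lambda>t. (0 * t, 0 * t))) (at 0)"
    unfolding has_field_derivative_def by (intro has_derivative_Pair)
  then have Dd: "(d has_derivative (\<lambda>t. 0)) (at 0)"
    by (simp add: zero_prod_def)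
  \<comment> \<open>Transporting \<open>d\<close> back by the inverse diffeomorphism, \<open>c\<close> has velocity 0 as well.\<close>
  have "0 \<in> V" using U \<phi>0 unfolding homeomorphism_def by force
  then have "(\<phi>' has_derivative frechet_derivative \<phi>' (at 0)) (at (d 0))"
    using smooth_on_has_derivative[OF U(5)] d0 by simp
  from has_derivative_compose[OF Dd this]
  have D: "((\<lambda>t. \<phi>' (d t)) has_derivative (\<lambda>t. 0)) (at 0)"
    using linear_0[OF has_derivative_linear[OF \<open>(\<phi>' has_derivative _) _\<close>]] by simp
  have "\<forall>\<^sub>F t in at 0. c t \<in> U"
    using eventually_compose_filterlim[OF eventually_nhds_in_open[OF U(1,2)] c_lim] .
  then have "\<forall>\<^sub>F t in at 0. \<phi>' (d t) = c t"
    by eventually_elim (use U(4) in \<open>simp add: homeomorphism_def d_def\<close>)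
  moreover have "\<phi>' (d 0) = c 0" using U(2,4) c(2) by (simp add: homeomorphism_def d_def)
  ultimately have "(c has_derivative (\<lambda>t. 0)) (at 0)"
    using has_derivative_transform_eventually[OF D] by simp
  then have "(\<lambda>t. t *\<^sub>R v) = (\<lambda>t::real. 0)"
    using c(1) has_derivative_unique unfolding has_vector_derivative_def by blast
  then have "1 *\<^sub>R v = 0" by metis
  with c(3) show False by simp
qed

text \<open>Second-order Taylor expansion when only the second derivative at 0 itself is known to exist, by
  L'Hopital's rule.\<close>

lemma quadratic_limit:
  fixes k :: "real \<Rightarrow> real"
  assumes "k 0 = 0" "\<forall>\<^sub>F t in nhds 0. (k has_field_derivative k' t) (at t)" "k' 0 = 0"
    "(k' has_field_derivative c) (at 0)"
  shows "((\<lambda>t. k t / t\<^sup>2) \<longlongrightarrow> c / 2) (at 0)"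
proof (rule lhopital)
  have "isCont k 0" using eventually_nhds_x_imp_x[OF assms(2)] DERIV_isCont by blast
  then show "(k \<longlongrightarrow> 0) (at 0)" using assms(1) by (simp add: isCont_def)
  show "((\<lambda>t. t\<^sup>2) \<longlongrightarrow> 0) (at (0::real))" by (auto intro!: tendsto_eq_intros)
  show "\<forall>\<^sub>F t in at 0. (t::real)\<^sup>2 \<noteq> 0" "\<forall>\<^sub>F t in at 0. 2 * (t::real) \<noteq> 0"
    by (auto simp: eventually_at_filter)
  show "\<forall>\<^sub>F t in at 0. (k has_field_derivative k' t) (at t)"
    using assms(2) by (auto simp: eventually_at_filter elim: eventually_mono)
  show "\<forall>\<^sub>F t in at 0. ((\<lambda>t. t\<^sup>2) has_field_derivative 2 * t) (at (t::real))"
    by (auto intro!: always_eventually derivative_eq_intros)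
  have "((\<lambda>t. k' t / t / 2) \<longlongrightarrow> c / 2) (at 0)"
    using assms(3,4) by (intro tendsto_divide tendsto_const) (simp_all add: has_field_derivative_iff)
  then show "((\<lambda>t. k' t / (2 * t)) \<longlongrightarrow> c / 2) (at 0)" by (simp add: mult.commute)
qed


section \<open>The apparent contour of a fold\<close>

lemma pd_along_fibres:
  assumes "smooth_near q p" "smooth_near (fst q, p q) g"
  shows "pd1 (\<lambda>q. g (fst q, p q)) q = pd1 g (fst q, p q) + pd2 g (fst q, p q) * pd1 p q"
    and "pd2 (\<lambda>q. g (fst q, p q)) q = pd2 g (fst q, p q) * pd2 p q"
proof -
  have "((\<lambda>q. (fst q, p q)) has_derivative (\<lambda>v. (fst v, pd1 p q * fst v + pd2 p q * snd v))) (at q)"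
    by (intro has_derivative_Pair has_derivative_fst has_derivative_ident smooth_near_pd assms)
  from has_derivative_pd[OF has_derivative_compose[OF this smooth_near_pd[OF assms(2)]]]
  show "pd1 (\<lambda>q. g (fst q, p q)) q = pd1 g (fst q, p q) + pd2 g (fst q, p q) * pd1 p q"
    and "pd2 (\<lambda>q. g (fst q, p q)) q = pd2 g (fst q, p q) * pd2 p q" by simp_all
qed

text \<open>Passing from \<open>g\<close> to \<open>h = g \<circ> (x, p)\<close> produces, besides the Hessian of \<open>g\<close>, terms with second
  derivatives of \<open>p\<close>. These come with the factor \<open>pd2 g 0\<close>, which vanishes because the critical points
  of \<open>h\<close> and of \<open>g\<close> correspond.\<close>

lemma hessian_along_fibres:
  assumes g: "smooth_near 0 g" and p: "smooth_near 0 p" "p 0 = 0" "pd2 p 0 = 1"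
    and h: "\<forall>\<^sub>F q in nhds 0. h q = g (fst q, p q)" "pd1 h 0 = 0" "pd2 h 0 = 0"
  shows "pd1 g 0 = 0" "pd2 g 0 = 0"
    "pd1 (pd1 h) 0 = pd1 (pd1 g) 0 + 2 * pd1 p 0 * pd2 (pd1 g) 0 + (pd1 p 0)\<^sup>2 * pd2 (pd2 g) 0"
    "pd2 (pd1 h) 0 = pd2 (pd1 g) 0 + pd1 p 0 * pd2 (pd2 g) 0"
    "pd2 (pd2 h) 0 = pd2 (pd2 g) 0"
proof -
  let ?\<Phi> = "\<lambda>q. (fst q, p q)"
  have \<Phi>: "smooth_near 0 ?\<Phi>"
    by (intro smooth_near_Pair smooth_near_bounded_linear[OF bounded_linear_fst] p)
  have \<Phi>0: "?\<Phi> 0 = 0" using p by (simp add: zero_prod_def)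
  have "(?\<Phi> \<longlongrightarrow> 0) (nhds 0)"
    using smooth_near_tendsto[OF \<Phi>] by (simp only: \<Phi>0)
  then have "\<forall>\<^sub>F q in nhds 0. smooth_near (?\<Phi> q) g"
    by (rule eventually_compose_filterlim[OF eventually_smooth_near[OF g]])
  with eventually_smooth_near[OF p(1)]
  have sm: "\<forall>\<^sub>F q in nhds 0. smooth_near (?\<Phi> q) g \<and> smooth_near q p"
    by eventually_elim simp
  have "\<forall>\<^sub>F q in nhds 0. pd1 h q = pd1 (\<lambda>q. g (?\<Phi> q)) q"
    "\<forall>\<^sub>F q in nhds 0. pd2 h q = pd2 (\<lambda>q. g (?\<Phi> q)) q"
    using eventually_pd_cong[OF h(1)] by simp_all
  with sm have h1: "\<forall>\<^sub>F q in nhds 0. pd1 h q = pd1 g (?\<Phi> q) + pd2 g (?\<Phi> q) * pd1 p q"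
    and h2: "\<forall>\<^sub>F q in nhds 0. pd2 h q = pd2 g (?\<Phi> q) * pd2 p q"
    by (eventually_elim, simp add: pd_along_fibres)+
  show g2: "pd2 g 0 = 0" using eventually_nhds_x_imp_x[OF h2] p h(3) by (simp add: zero_prod_def)
  show "pd1 g 0 = 0" using eventually_nhds_x_imp_x[OF h1] g2 p h(2) by (simp add: zero_prod_def)
  have s: "smooth_near 0 (\<lambda>q. pd1 g (?\<Phi> q))" "smooth_near 0 (\<lambda>q. pd2 g (?\<Phi> q))"
    by (rule smooth_near_compose[OF \<Phi>], simp only: \<Phi>0, intro smooth_near_partials g)+
  note sp = s p(1) smooth_near_partials[OF p(1)] smooth_near_partials[OF g]
  have c: "pd1 (\<lambda>q. f (?\<Phi> q)) 0 = pd1 f 0 + pd2 f 0 * pd1 p 0"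
     "pd2 (\<lambda>q. f (?\<Phi> q)) 0 = pd2 f 0" if "smooth_near 0 f" for f
    using pd_along_fibres[OF p(1), of f] that p \<Phi>0 by simp_all
  show "pd1 (pd1 h) 0 = pd1 (pd1 g) 0 + 2 * pd1 p 0 * pd2 (pd1 g) 0 + (pd1 p 0)\<^sup>2 * pd2 (pd2 g) 0"
    using eventually_pd_eqD(1)[OF h1] g2 mixed_partials_commute[OF g]
    by (simp add: pd_add pd_mult smooth_near_mult sp c p \<Phi>0[simplified] zero_prod_def[symmetric] power2_eq_square algebra_simps)
  show "pd2 (pd1 h) 0 = pd2 (pd1 g) 0 + pd1 p 0 * pd2 (pd2 g) 0"
    using eventually_pd_eqD(2)[OF h1] g2
    by (simp add: pd_add pd_mult smooth_near_mult sp c p \<Phi>0[simplified] zero_prod_def[symmetric] algebra_simps)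
  show "pd2 (pd2 h) 0 = pd2 (pd2 g) 0"
    using eventually_pd_eqD(2)[OF h2] g2
    by (simp add: pd_add pd_mult smooth_near_mult sp c p \<Phi>0[simplified] zero_prod_def[symmetric] algebra_simps)
qed

lemma DERIV_along_graph:
  assumes "(x has_field_derivative x') (at t)" "smooth_near (x t, t) g"
  shows "((\<lambda>t. g (x t, t)) has_field_derivative pd1 g (x t, t) * x' + pd2 g (x t, t)) (at t)"
proof -
  have "((\<lambda>t. (x t, t)) has_derivative (\<lambda>s. (x' * s, s))) (at t)"
    using assms(1) unfolding has_field_derivative_def by (intro has_derivative_Pair has_derivative_ident)
  from has_derivative_compose[OF this smooth_near_pd[OF assms(2)]] show ?thesis
    unfolding has_field_derivative_def by (rule has_derivative_eq_rhs) (simp add: fun_eq_iff algebra_simps)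
qed

text \<open>Since \<open>g\<^sub>x (x t, t) = 0\<close>, the second coordinate of the contour has derivative \<open>g\<^sub>y (x t, t)\<close>, which is 0
  at \<open>t = 0\<close>. Hence the curvature there is the second derivative \<open>g\<^sub>x\<^sub>y m + g\<^sub>y\<^sub>y\<close> with \<open>m\<close> the derivative of
  \<open>x\<close> at 0, and differentiating \<open>g\<^sub>x (x t, t) = 0\<close> gives \<open>m = - g\<^sub>x\<^sub>y / g\<^sub>x\<^sub>x\<close>.\<close>

lemma plane_curvature_contour:
  assumes g: "smooth_near 0 g" "pd2 g 0 = 0" "pd1 (pd1 g) 0 \<noteq> 0"
    and x: "contour_generator_param g x"
  shows "plane_curvature (\<lambda>t. (t, g (x t, t))) 0 =
    (pd1 (pd1 g) 0 * pd2 (pd2 g) 0 - (pd2 (pd1 g) 0)\<^sup>2) / pd1 (pd1 g) 0"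
proof -
  have xs: "smooth_near 0 x" and x0: "x 0 = 0"
    and ev: "\<forall>\<^sub>F z in nhds 0. (case z of (s, t) \<Rightarrow> pd1 g (s, t) = 0 \<longleftrightarrow> s = x t)"
    using x unfolding contour_generator_param_def by auto
  have "((\<lambda>t. (x t, t)) \<longlongrightarrow> (x 0, 0)) (nhds 0)"
    by (intro tendsto_Pair filterlim_ident smooth_near_tendsto xs)
  then have lim: "((\<lambda>t. (x t, t)) \<longlongrightarrow> 0) (nhds 0)" by (simp add: x0 zero_prod_def)
  have crit: "\<forall>\<^sub>F t in nhds 0. pd1 g (x t, t) = 0"
    using eventually_compose_filterlim[OF ev lim] by simp
  have "\<forall>\<^sub>F t in nhds 0. ((\<lambda>t. g (x t, t)) has_field_derivative pd2 g (x t, t)) (at t)"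
    using crit eventually_compose_filterlim[OF eventually_smooth_near[OF g(1)] lim] eventually_smooth_near[OF xs]
  proof eventually_elim
    case (elim t)
    then show ?case using DERIV_along_graph[OF smooth_near_real_DERIV[OF elim(3)] elim(2)] by simp
  qed
  then have Y': "\<forall>\<^sub>F t in nhds 0. deriv (\<lambda>t. g (x t, t)) t = pd2 g (x t, t)"
    by eventually_elim (rule DERIV_imp_deriv)
  define m where "m = deriv x 0"
  have D: "((\<lambda>t. f (x t, t)) has_field_derivative pd1 f 0 * m + pd2 f 0) (at 0)" if "smooth_near 0 f" for f
    using DERIV_along_graph[OF smooth_near_real_DERIV[OF xs], of f] that
    by (simp add: x0 m_def zero_prod_def)
  have "deriv (deriv (\<lambda>t. g (x t, t))) 0 = deriv (\<lambda>t. pd2 g (x t, t)) 0"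
    by (rule deriv_cong_ev[OF Y' refl])
  also have "\<dots> = pd1 (pd2 g) 0 * m + pd2 (pd2 g) 0"
    by (intro DERIV_imp_deriv D smooth_near_partials g)
  finally have Y'': "deriv (deriv (\<lambda>t. g (x t, t))) 0 = pd2 (pd1 g) 0 * m + pd2 (pd2 g) 0"
    by (simp add: mixed_partials_commute[OF g(1)])
  have "deriv (\<lambda>t. pd1 g (x t, t)) 0 = deriv (\<lambda>t. 0) 0"
    by (rule deriv_cong_ev[OF crit refl])
  moreover have "deriv (\<lambda>t. pd1 g (x t, t)) 0 = pd1 (pd1 g) 0 * m + pd2 (pd1 g) 0"
    by (intro DERIV_imp_deriv D smooth_near_partials g)
  ultimately have m: "m = - pd2 (pd1 g) 0 / pd1 (pd1 g) 0"
    using g(3) by (simp add: field_simps)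
  have "deriv (\<lambda>t. g (x t, t)) 0 = 0"
    using eventually_nhds_x_imp_x[OF Y'] g(2) by (simp add: x0 zero_prod_def)
  then have "plane_curvature (\<lambda>t. (t, g (x t, t))) 0 = pd2 (pd1 g) 0 * m + pd2 (pd2 g) 0"
    by (simp add: plane_curvature_def Y'')
  also have "\<dots> = (pd1 (pd1 g) 0 * pd2 (pd2 g) 0 - (pd2 (pd1 g) 0)\<^sup>2) / pd1 (pd1 g) 0"
    using g(3) by (simp add: m field_simps power2_eq_square)
  finally show ?thesis .
qed

text \<open>Solve \<open>g\<^sub>x (s, t) = z\<close> for \<open>s\<close> and put \<open>z = 0\<close>. The variables are exchanged first, since
  \<open>parametrized_inverse\<close> solves for the second one.\<close>

lemma contour_generator_exists:
  assumes g: "smooth_near 0 g" "pd1 g 0 = 0" "pd1 (pd1 g) 0 \<noteq> 0"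
  shows "\<exists>x. contour_generator_param g x"
proof -
  define F where "F q = pd1 g (snd q, fst q)" for q
  have "smooth_near 0 (\<lambda>q::real \<times> real. (snd q, fst q))"
    by (intro smooth_near_bounded_linear bounded_linear_Pair bounded_linear_fst bounded_linear_snd)
  from smooth_near_compose[OF this, of "pd1 g"] have "smooth_near 0 F"
    using smooth_near_partials(1)[OF g(1)] by (simp add: F_def[abs_def] zero_prod_def)
  moreover have "F 0 = 0" using g(2) by (simp add: F_def zero_prod_def)
  moreover have "pd2 F (a, b) = pd1 (pd1 g) (b, a)" for a b
    by (simp add: F_def pd1_def pd2_def)
  then have "pd2 F 0 \<noteq> 0" using g(3) by (simp add: zero_prod_def)
  ultimately obtain G where G: "smooth_near 0 G" "G 0 = 0"
    "\<forall>\<^sub>F (t, s) in nhds 0. G (t, F (t, s)) = s" "\<forall>\<^sub>F (t, z) in nhds 0. F (t, G (t, z)) = z"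
    by (rule parametrized_inverse)
  define x where "x t = G (t, 0)" for t
  have lim: "((\<lambda>t. (t, 0)) \<longlongrightarrow> (0::real \<times> real)) (nhds 0)"
    unfolding zero_prod_def by (intro tendsto_Pair filterlim_ident tendsto_const)
  have "smooth_near 0 (\<lambda>t::real. (t, 0::real))"
    by (intro smooth_near_bounded_linear bounded_linear_Pair bounded_linear_ident bounded_linear_zero)
  from smooth_near_compose[OF this, of G] have "smooth_near 0 x"
    using G(1) by (simp add: x_def[abs_def] zero_prod_def)
  moreover have "x 0 = 0" using G(2) by (simp add: x_def zero_prod_def)
  moreover have "\<forall>\<^sub>F (s, t) in nhds 0. pd1 g (s, t) = 0 \<longleftrightarrow> s = x t"
  proof -
    have swap: "((\<lambda>q. (snd q, fst q)) \<longlongrightarrow> (0::real \<times> real)) (nhds 0)"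
      by (rule tendsto_eq_rhs[OF tendsto_Pair[OF tendsto_snd tendsto_fst]], rule filterlim_ident, rule filterlim_ident)
         (simp add: zero_prod_def)
    have snd: "(snd \<longlongrightarrow> (0::real)) (nhds (0::real \<times> real))"
      by (rule tendsto_eq_rhs[OF tendsto_snd], rule filterlim_ident) simp
    have "\<forall>\<^sub>F t in nhds 0. F (t, G (t, 0)) = 0"
      using eventually_compose_filterlim[OF G(4) lim] by simp
    then have "\<forall>\<^sub>F q in nhds (0::real \<times> real). F (snd q, x (snd q)) = 0"
      unfolding x_def by (rule eventually_compose_filterlim[OF _ snd])
    moreover have "\<forall>\<^sub>F q in nhds 0. G (snd q, F (snd q, fst q)) = fst q"
      using eventually_compose_filterlim[OF G(3) swap] by simp
    ultimately show ?thesis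
      by eventually_elim (auto simp: F_def x_def)
  qed
  ultimately show ?thesis unfolding contour_generator_param_def by blast
qed

text \<open>The inverse of the coordinate change \<open>(x, y) \<mapsto> (x, p (x, y))\<close> is \<open>(x, z) \<mapsto> (x, G (x, z))\<close>. The curve
  \<open>t \<mapsto> (t, G (t, 0))\<close> is the new \<open>x\<close>-axis, the fibre of \<open>p\<close> through the origin; on it the first
  component of the map vanishes identically.\<close>

lemma adapted_form_exists:
  assumes P: "smooth_near 0 p" "smooth_near 0 h" and p: "p 0 = 0" "pd2 p 0 \<noteq> 0"
  obtains g and G :: "real \<times> real \<Rightarrow> real" where "adapted_form (\<lambda>q. (p q, h q)) g" "smooth_near 0 G" "G 0 = 0"
    "\<forall>\<^sub>F t in nhds 0. (p (t, G (t, 0)), h (t, G (t, 0))) = (0, g (t, 0))"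
proof -
  obtain G where G: "smooth_near 0 G" "G 0 = 0"
    "\<forall>\<^sub>F (x, y) in nhds 0. G (x, p (x, y)) = y" "\<forall>\<^sub>F (x, z) in nhds 0. p (x, G (x, z)) = z"
    by (rule parametrized_inverse[OF P(1) p])
  define g where "g z = h (fst z, G z)" for z
  have "smooth_near 0 (\<lambda>z. (fst z, G z))"
    by (intro smooth_near_Pair smooth_near_bounded_linear[OF bounded_linear_fst] G)
  from smooth_near_compose[OF this, of h] have "smooth_near 0 g"
    using P(2) G(2) by (simp add: g_def[abs_def] zero_prod_def)
  then have adapted: "adapted_form (\<lambda>q. (p q, h q)) g"
    using G(3) by (auto simp: adapted_form_def g_def elim!: eventually_mono)
  have "((\<lambda>t. (t, 0)) \<longlongrightarrow> (0::real \<times> real)) (nhds 0)"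
    unfolding zero_prod_def by (intro tendsto_Pair filterlim_ident tendsto_const)
  from eventually_compose_filterlim[OF G(4) this]
  have curve: "\<forall>\<^sub>F t in nhds 0. (p (t, G (t, 0)), h (t, G (t, 0))) = (0, g (t, 0))"
    by (simp add: g_def)
  show thesis by (rule that[of g G, OF adapted G(1,2) curve])
qed

lemma adapted_form_eventually:
  assumes "adapted_form (\<lambda>q. (p q, h q)) g"
  shows "smooth_near 0 g" "\<forall>\<^sub>F q in nhds 0. h q = g (fst q, p q)"
  using assms by (auto simp: adapted_form_def elim!: eventually_mono)

text \<open>On the \<open>x\<close>-axis of the adapted coordinates the map is \<open>(0, g (t, 0))\<close>, which is \<open>o(t\<^sup>2)\<close> if
  \<open>pd1 (pd1 g) 0 = 0\<close>.\<close>

lemma adapted_form_of_fold_nondegenerate: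
  assumes fold: "fold_singularity (\<lambda>q. (p q, h q))"
    and p: "smooth_near 0 p" "p 0 = 0" "pd2 p 0 = 1"
    and h: "smooth_near 0 h" "h 0 = 0" "pd1 h 0 = 0" "pd2 h 0 = 0"
  obtains g where "adapted_form (\<lambda>q. (p q, h q)) g" "pd1 (pd1 g) 0 \<noteq> 0"
proof -
  have p2: "pd2 p 0 \<noteq> 0" using p(3) by simp
  obtain g and G :: "real \<times> real \<Rightarrow> real" where g: "adapted_form (\<lambda>q. (p q, h q)) g"
    and G: "smooth_near 0 G" "G 0 = 0"
    and PG: "\<forall>\<^sub>F t in nhds 0. (p (t, G (t, 0)), h (t, G (t, 0))) = (0, g (t, 0))"
    by (rule adapted_form_exists[OF p(1) h(1) p(2) p2])
  note gs = adapted_form_eventually(1)[OF g] and gh = adapted_form_eventually(2)[OF g]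
  have g0: "g 0 = 0" using eventually_nhds_x_imp_x[OF gh] p(2) h(2) by (simp add: zero_prod_def)
  have g1: "pd1 g 0 = 0" by (rule hessian_along_fibres(1)[OF gs p gh h(3,4)])
  have lim: "((\<lambda>t. (t, 0)) \<longlongrightarrow> (0::real \<times> real)) (nhds 0)"
    unfolding zero_prod_def by (intro tendsto_Pair filterlim_ident tendsto_const)
  have "pd1 (pd1 g) 0 \<noteq> 0"
  proof
    assume g11: "pd1 (pd1 g) 0 = 0"
    have quad: "((\<lambda>t. g (t, 0) / t\<^sup>2) \<longlongrightarrow> pd1 (pd1 g) 0 / 2) (at 0)"
    proof (rule quadratic_limit)
      show "\<forall>\<^sub>F t in nhds 0. ((\<lambda>t. g (t, 0)) has_field_derivative pd1 g (t, 0)) (at t)"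
        using eventually_compose_filterlim[OF eventually_smooth_near[OF gs] lim]
        by eventually_elim (rule smooth_near_DERIV)
      show "((\<lambda>t. pd1 g (t, 0)) has_field_derivative pd1 (pd1 g) 0) (at 0)"
        using smooth_near_DERIV(1)[of 0 0 "pd1 g"] smooth_near_partials(1)[OF gs] by (simp add: zero_prod_def)
    qed (use g0 g1 in \<open>simp_all add: zero_prod_def\<close>)
    define c where "c t = (t, G (t, 0))" for t
    have "((\<lambda>t. G (t, 0)) has_field_derivative pd1 G 0) (at 0)"
      using smooth_near_DERIV(1)[of 0 0 G] G(1) by (simp add: zero_prod_def)
    then have "(c has_vector_derivative (1, pd1 G 0)) (at 0)"
      unfolding c_def by (intro has_vector_derivative_Pair)
        (simp_all add: has_real_derivative_iff_has_vector_derivative)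
    moreover have "c 0 = 0" using G(2) by (simp add: c_def zero_prod_def)
    moreover have "(1::real, pd1 G 0) \<noteq> 0" by (simp add: zero_prod_def)
    ultimately have "\<not> ((\<lambda>t. inverse (t\<^sup>2) *\<^sub>R (p (c t), h (c t))) \<longlongrightarrow> 0) (at 0)"
      by (rule fold_singularity_no_flat_curve[OF fold])
    moreover have "((\<lambda>t. inverse (t\<^sup>2) *\<^sub>R (p (c t), h (c t))) \<longlongrightarrow> 0) (at 0)"
    proof (rule Lim_transform_eventually)
      show "((\<lambda>t. (0::real, g (t, 0) / t\<^sup>2)) \<longlongrightarrow> 0) (at 0)"
        using quad g11 unfolding zero_prod_def by (intro tendsto_Pair tendsto_const) simp
      show "\<forall>\<^sub>F t in at 0. (0, g (t, 0) / t\<^sup>2) = inverse (t\<^sup>2) *\<^sub>R (p (c t), h (c t))"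
        using PG unfolding eventually_at_filter
        by eventually_elim (simp add: c_def divide_inverse mult.commute)
    qed
    ultimately show False by blast
  qed
  with g show thesis by (rule that)
qed

text \<open>The factor on the left is \<open>pd1 (pd1 g) 0\<close> and the right-hand side the determinant of the Hessian of
  \<open>g\<close>, both for every adapted form \<open>g\<close>, by \<open>hessian_along_fibres\<close>. Their quotient therefore depends on
  \<open>h\<close> and \<open>p\<close> only, and the description that defines the curvature determines a unique number.\<close>

lemma apparent_contour_curvature_of_fold:
  assumes fold: "fold_singularity (\<lambda>q. (p q, h q))"
    and p: "smooth_near 0 p" "p 0 = 0" "pd2 p 0 = 1"
    and h: "smooth_near 0 h" "h 0 = 0" "pd1 h 0 = 0" "pd2 h 0 = 0"
  shows "apparent_contour_curvature (\<lambda>q. (p q, h q)) *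
      (pd1 (pd1 h) 0 - 2 * pd1 p 0 * pd2 (pd1 h) 0 + (pd1 p 0)\<^sup>2 * pd2 (pd2 h) 0) =
    pd1 (pd1 h) 0 * pd2 (pd2 h) 0 - (pd2 (pd1 h) 0)\<^sup>2"
proof -
  let ?P = "\<lambda>q. (p q, h q)"
  define s where "s = pd1 (pd1 h) 0 - 2 * pd1 p 0 * pd2 (pd1 h) 0 + (pd1 p 0)\<^sup>2 * pd2 (pd2 h) 0"
  define K where "K = pd1 (pd1 h) 0 * pd2 (pd2 h) 0 - (pd2 (pd1 h) 0)\<^sup>2"
  have hess: "pd1 g 0 = 0" "pd2 g 0 = 0" "pd1 (pd1 g) 0 = s"
    "pd1 (pd1 g) 0 * pd2 (pd2 g) 0 - (pd2 (pd1 g) 0)\<^sup>2 = K" if "adapted_form ?P g" for g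
  proof -
    note H = hessian_along_fibres[OF adapted_form_eventually(1)[OF that] p adapted_form_eventually(2)[OF that] h(3,4)]
    show "pd1 g 0 = 0" "pd2 g 0 = 0" by (rule H)+
    show "pd1 (pd1 g) 0 = s"
      unfolding s_def H(3-5) by (simp add: power2_eq_square algebra_simps)
    show "pd1 (pd1 g) 0 * pd2 (pd2 g) 0 - (pd2 (pd1 g) 0)\<^sup>2 = K"
      unfolding K_def H(3-5) by (simp add: power2_eq_square algebra_simps)
  qed
  obtain g where g: "adapted_form ?P g" "pd1 (pd1 g) 0 \<noteq> 0"
    by (rule adapted_form_of_fold_nondegenerate[OF fold p h])
  have s: "s \<noteq> 0" using hess(3)[OF g(1)] g(2) by simp
  have curv: "plane_curvature (\<lambda>t. (t, g (x t, t))) 0 = K / s"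
    if "adapted_form ?P g" "contour_generator_param g x" for g x
    using plane_curvature_contour[OF adapted_form_eventually(1)[OF that(1)] _ _ that(2)] hess[OF that(1)] s
    by simp
  obtain x where x: "contour_generator_param g x"
    using contour_generator_exists[OF adapted_form_eventually(1)[OF g(1)] hess(1)[OF g(1)] g(2)] by blast
  have "apparent_contour_curvature ?P = K / s"
    unfolding apparent_contour_curvature_def
  proof (rule the_equality)
    show "\<exists>g x. adapted_form ?P g \<and> contour_generator_param g x \<and> K / s = plane_curvature (\<lambda>t. (t, g (x t, t))) 0"
      using g(1) x curv[OF g(1) x] by metis
    show "k = K / s" if "\<exists>g x. adapted_form ?P g \<and> contour_generator_param g x \<and> k = plane_curvature (\<lambda>t. (t, g (x t, t))) 0" for k
      using that curv by metis
  qed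
  then show ?thesis using s unfolding s_def[symmetric] K_def[symmetric] by simp
qed


section \<open>Surfaces in Monge form\<close>

lemma vector_4_eq: "(vector [a, b, c, d] :: real^4) = a *\<^sub>R axis 1 1 + b *\<^sub>R axis 2 1 + c *\<^sub>R axis 3 1 + d *\<^sub>R axis 4 1"
  by (simp add: vec_eq_iff forall_4 axis_def)

lemma inner_4: "(v :: real^4) \<bullet> w = v$1 * w$1 + v$2 * w$2 + v$3 * w$3 + v$4 * w$4"
  by (simp add: inner_vec_def sum_4)

lemma monge_has_derivative:
  assumes "smooth_near q f1" "smooth_near q f2"
  shows "(monge f1 f2 has_derivative (\<lambda>v. vector [fst v, snd v, pd1 f1 q * fst v + pd2 f1 q * snd v,
    pd1 f2 q * fst v + pd2 f2 q * snd v])) (at q)"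
proof -
  have "monge f1 f2 = (\<lambda>q. fst q *\<^sub>R axis 1 1 + snd q *\<^sub>R axis 2 1 + f1 q *\<^sub>R axis 3 1 + f2 q *\<^sub>R axis 4 1)"
    by (auto simp: monge_def vector_4_eq)
  then show ?thesis unfolding vector_4_eq
    by (auto intro!: has_derivative_add has_derivative_scaleR_left has_derivative_fst has_derivative_snd
        has_derivative_ident smooth_near_pd assms)
qed

text \<open>The velocity of the image of the line through \<open>q\<close> with direction \<open>(a, b)\<close>, which stays in \<open>U\<close> for a
  while.\<close>

lemma monge_tangent:
  assumes U: "open U" "q \<in> U" "monge f1 f2 ` U \<subseteq> M"
    and f: "smooth_near q f1" "smooth_near q f2"
  shows "vector [a, b, pd1 f1 q * a + pd2 f1 q * b, pd1 f2 q * a + pd2 f2 q * b] \<in> tangent_space M (monge f1 f2 q)"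
proof -
  define c where "c t = q + t *\<^sub>R (a, b)" for t :: real
  have c: "(c has_derivative (\<lambda>t. t *\<^sub>R (a, b))) (at 0)"
    unfolding c_def by (auto intro!: derivative_eq_intros)
  have c0: "c 0 = q" by (simp add: c_def zero_prod_def[symmetric])
  have "(monge f1 f2 has_derivative (\<lambda>v. vector [fst v, snd v, pd1 f1 q * fst v + pd2 f1 q * snd v,
    pd1 f2 q * fst v + pd2 f2 q * snd v])) (at (c 0))"
    unfolding c0 by (rule monge_has_derivative[OF f])
  from has_derivative_compose[OF c this]
  have "((\<lambda>t. monge f1 f2 (c t)) has_vector_derivative
      vector [a, b, pd1 f1 q * a + pd2 f1 q * b, pd1 f2 q * a + pd2 f2 q * b]) (at 0)"
    unfolding has_vector_derivative_def
    by (rule has_derivative_eq_rhs) (auto simp: vec_eq_iff forall_4 algebra_simps)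
  moreover have "isCont c 0" using c has_derivative_continuous by blast
  then have "(c \<longlongrightarrow> q) (nhds 0)" using isCont_tendsto_nhds c0 by metis
  then have "\<forall>\<^sub>F t in nhds 0. c t \<in> U"
    by (rule eventually_compose_filterlim[OF eventually_nhds_in_open[OF U(1,2)]])
  then have "\<forall>\<^sub>F t in nhds 0. monge f1 f2 (c t) \<in> M"
    by eventually_elim (use U(3) in blast)
  ultimately show ?thesis
    unfolding tangent_space_def using c0 by (intro CollectI exI[of _ "\<lambda>t. monge f1 f2 (c t)"]) auto
qed

lemma zero_1jet_pd:
  assumes "zero_1jet f" shows "f 0 = 0" "pd1 f 0 = 0" "pd2 f 0 = 0"
  using assms has_derivative_pd[of f "\<lambda>_. 0" 0] by (auto simp: zero_1jet_def)

lemma monge_zero: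
  assumes "f1 0 = 0" "f2 0 = 0" shows "monge f1 f2 0 = 0"
  using assms by (simp add: monge_def zero_prod_def vec_eq_iff forall_4)

text \<open>Besides unpacking the definition, this records that the origin lies on the surface and in the window
  \<open>W\<close>: it is the image of the parameter 0, since the 0-jets vanish.\<close>

lemma monge_formE:
  assumes "in_monge_form M f1 f2"
  obtains U W where "open U" "0 \<in> U" "open W" "0 \<in> W" "M \<inter> W = monge f1 f2 ` U"
    "\<And>q. q \<in> U \<Longrightarrow> smooth_near q f1" "\<And>q. q \<in> U \<Longrightarrow> smooth_near q f2"
    "monge f1 f2 0 = 0"
proof -
  obtain U W where U: "open U" "0 \<in> U" "open W" "smooth_on U f1" "smooth_on U f2" "M \<inter> W = monge f1 f2 ` U"
    and z: "zero_1jet f1" "zero_1jet f2"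
    using assms unfolding in_monge_form_def by blast
  have m0: "monge f1 f2 0 = 0" using zero_1jet_pd(1)[OF z(1)] zero_1jet_pd(1)[OF z(2)] by (rule monge_zero)
  then have "0 \<in> M \<inter> W" unfolding U(6) using U(2) by force
  moreover have "smooth_near q f1" "smooth_near q f2" if "q \<in> U" for q
    using U that unfolding smooth_near_def by blast+
  ultimately show thesis using that U m0 by blast
qed

text \<open>A curve in the surface that stays in the window \<open>W\<close> satisfies \<open>z\<^sub>3 = f\<^sup>1 (z\<^sub>1, z\<^sub>2)\<close> and \<open>z\<^sub>4 = f\<^sup>2 (z\<^sub>1, z\<^sub>2)\<close>,
  and the derivatives of the right-hand sides at the origin are 0. The other inclusion is
  \<open>monge_tangent\<close> at the parameter 0.\<close>

lemma tangent_space_monge: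
  assumes "in_monge_form M f1 f2"
  shows "tangent_space M 0 = {v. v$3 = 0 \<and> v$4 = 0}"
proof -
  obtain U W where U: "open U" "0 \<in> U" "open W" "0 \<in> W" "M \<inter> W = monge f1 f2 ` U"
    and f: "\<And>q. q \<in> U \<Longrightarrow> smooth_near q f1" "\<And>q. q \<in> U \<Longrightarrow> smooth_near q f2"
    and m0: "monge f1 f2 0 = 0"
    by (rule monge_formE[OF assms]) blast
  have z: "zero_1jet f1" "zero_1jet f2" using assms unfolding in_monge_form_def by blast+
  note pd0 = zero_1jet_pd[OF z(1)] zero_1jet_pd[OF z(2)]
  show ?thesis
  proof (intro set_eqI iffI)
    fix v :: "real^4" assume "v \<in> {v. v$3 = 0 \<and> v$4 = 0}"
    then have "v = vector [v$1, v$2, pd1 f1 0 * v$1 + pd2 f1 0 * v$2, pd1 f2 0 * v$1 + pd2 f2 0 * v$2]"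
      by (simp add: vec_eq_iff forall_4 pd0)
    moreover have "\<dots> \<in> tangent_space M (monge f1 f2 0)"
      using U f by (intro monge_tangent[of U]) auto
    ultimately show "v \<in> tangent_space M 0" by (simp only: m0)
  next
    fix v :: "real^4" assume "v \<in> tangent_space M 0"
    then obtain \<gamma> where \<gamma>: "\<gamma> 0 = 0" "\<forall>\<^sub>F t in nhds (0::real). \<gamma> t \<in> M" "(\<gamma> has_vector_derivative v) (at 0)"
      unfolding tangent_space_def by blast
    have "isCont \<gamma> 0" using \<gamma>(3) has_vector_derivative_continuous by blast
    then have "(\<gamma> \<longlongrightarrow> 0) (nhds 0)" using isCont_tendsto_nhds \<gamma>(1) by metis
    then have "\<forall>\<^sub>F t in nhds 0. \<gamma> t \<in> W"
      by (rule eventually_compose_filterlim[OF eventually_nhds_in_open[OF U(3,4)]])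
    with \<gamma>(2) have "\<forall>\<^sub>F t in nhds 0. \<gamma> t \<in> monge f1 f2 ` U"
      by eventually_elim (use U(5) in blast)
    then have g: "\<forall>\<^sub>F t in nhds 0. f1 (\<gamma> t $ 1, \<gamma> t $ 2) = \<gamma> t $ 3 \<and> f2 (\<gamma> t $ 1, \<gamma> t $ 2) = \<gamma> t $ 4"
      by eventually_elim (auto simp: monge_def)
    have c: "((\<lambda>t. \<gamma> t $ i) has_derivative (\<lambda>t. t * v $ i)) (at 0)" for i
      using bounded_linear.has_vector_derivative[OF bounded_linear_vec_nth \<gamma>(3), of i]
      by (simp add: has_vector_derivative_def)
    have *: "v $ i = 0"
      if ev: "\<forall>\<^sub>F t in nhds 0. f (\<gamma> t $ 1, \<gamma> t $ 2) = \<gamma> t $ i" and z: "zero_1jet f" for f i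
    proof -
      have "(f has_derivative (\<lambda>_. 0)) (at (\<gamma> 0 $ 1, \<gamma> 0 $ 2))"
        using z by (simp add: zero_1jet_def \<gamma>(1) zero_prod_def)
      from has_derivative_compose[OF has_derivative_Pair[OF c c] this]
      have "((\<lambda>t. f (\<gamma> t $ 1, \<gamma> t $ 2)) has_derivative (\<lambda>_. 0)) (at 0)" .
      then have "((\<lambda>t. \<gamma> t $ i) has_derivative (\<lambda>_. 0)) (at 0)"
        by (rule has_derivative_transform_eventually)
           (use ev eventually_nhds_x_imp_x[OF ev] in \<open>auto simp: eventually_at_filter elim: eventually_mono\<close>)
      then have "(\<lambda>t. t * v $ i) = (\<lambda>_. 0)" using c has_derivative_unique by blast
      then have "1 * v $ i = 0" by metis
      then show ?thesis by simp
    qed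
    show "v \<in> {v. v$3 = 0 \<and> v$4 = 0}"
      using *[of f1 3] *[of f2 4] g z by (simp add: eventually_conj_iff)
  qed
qed

lemma closest_point_horizontal:
  "closest_point {v :: real^4. v$3 = 0 \<and> v$4 = 0} z = vector [z$1, z$2, 0, 0]"
proof -
  let ?T = "{v :: real^4. v$3 = 0 \<and> v$4 = 0}"
  have "vector [z$1, z$2, 0, 0] = closest_point ?T z"
  proof (rule closest_point_unique)
    show "convex ?T" by (auto simp: convex_def)
    show "closed ?T" by (intro closed_Collect_conj closed_Collect_eq continuous_intros)
    show "\<forall>v\<in>?T. dist z (vector [z$1, z$2, 0, 0]) \<le> dist z v"
      by (auto simp: dist_norm norm_le inner_4 intro!: add_mono)
  qed simp
  then show ?thesis by simp
qed

text \<open>The Weingarten equations at the origin. Near 0 the normal field along the surface, \<open>N q\<close>, is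
  orthogonal to every tangent vector \<open>R q\<close> with constant first two components \<open>a\<close>, \<open>b\<close>. Differentiate
  \<open>N \<bullet> R = 0\<close> in the direction \<open>(a', b')\<close>: the term with \<open>R'\<close> consists of second derivatives of \<open>f1\<close>, \<open>f2\<close>
  and the components 3 and 4 of \<open>\<nu> 0\<close>, and \<open>R 0\<close> is \<open>(a, b, 0, 0)\<close>.\<close>

lemma normal_field_derivative:
  assumes M: "in_monge_form M f1 f2" and \<nu>: "normal_field M 0 \<nu>"
  defines "D \<equiv> frechet_derivative \<nu> (at 0)"
  shows "D (axis 1 1) $ 1 = - (\<nu> 0 $ 3 * pd1 (pd1 f1) 0 + \<nu> 0 $ 4 * pd1 (pd1 f2) 0)"
    and "D (axis 2 1) $ 1 = - (\<nu> 0 $ 3 * pd2 (pd1 f1) 0 + \<nu> 0 $ 4 * pd2 (pd1 f2) 0)"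
    and "D (axis 1 1) $ 2 = - (\<nu> 0 $ 3 * pd2 (pd1 f1) 0 + \<nu> 0 $ 4 * pd2 (pd1 f2) 0)"
    and "D (axis 2 1) $ 2 = - (\<nu> 0 $ 3 * pd2 (pd2 f1) 0 + \<nu> 0 $ 4 * pd2 (pd2 f2) 0)"
proof -
  obtain U W where U: "open U" "0 \<in> U" "open W" "0 \<in> W" "M \<inter> W = monge f1 f2 ` U"
    and f: "\<And>q. q \<in> U \<Longrightarrow> smooth_near q f1" "\<And>q. q \<in> U \<Longrightarrow> smooth_near q f2"
    and m0: "monge f1 f2 0 = 0"
    by (rule monge_formE[OF M]) blast
  have z: "zero_1jet f1" "zero_1jet f2" using M unfolding in_monge_form_def by blast+
  note pd0 = zero_1jet_pd[OF z(1)] zero_1jet_pd[OF z(2)]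
  note f0 = f[OF U(2)]
  define N where "N q = \<nu> (monge f1 f2 q)" for q
  have MD: "(monge f1 f2 has_derivative (\<lambda>v. vector [fst v, snd v, 0, 0])) (at 0)"
    using monge_has_derivative[OF f0] by (simp add: pd0)
  have "(\<nu> has_derivative D) (at (monge f1 f2 0))"
    using \<nu> smooth_near_has_derivative unfolding normal_field_def D_def m0 by blast
  from has_derivative_compose[OF MD this]
  have ND: "(N has_derivative (\<lambda>v. D (vector [fst v, snd v, 0, 0]))) (at 0)"
    unfolding N_def .
  have N0: "N 0 = \<nu> 0" by (simp add: N_def m0)
  have "(monge f1 f2 \<longlongrightarrow> 0) (nhds 0)"
    using isCont_tendsto_nhds[OF has_derivative_continuous[OF MD]] by (simp only: m0)
  moreover have "\<forall>\<^sub>F z in nhds 0. z \<in> M \<longrightarrow> (\<forall>v\<in>tangent_space M z. \<nu> z \<bullet> v = 0)"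
    using \<nu> unfolding normal_field_def by blast
  ultimately have perp: "\<forall>\<^sub>F q in nhds 0. monge f1 f2 q \<in> M \<longrightarrow> (\<forall>v\<in>tangent_space M (monge f1 f2 q). N q \<bullet> v = 0)"
    unfolding N_def by (rule eventually_compose_filterlim[rotated])
  have orth: "\<forall>\<^sub>F q in nhds 0. N q \<bullet> vector [a, b, pd1 f1 q * a + pd2 f1 q * b, pd1 f2 q * a + pd2 f2 q * b] = 0" for a b
    using perp eventually_nhds_in_open[OF U(1,2)]
  proof eventually_elim
    case (elim q)
    have sub: "monge f1 f2 ` U \<subseteq> M" using U(5) by blast
    then have "monge f1 f2 q \<in> M" using elim(2) by blast
    with elim(1) monge_tangent[OF U(1) elim(2) sub f[OF elim(2)]] show ?case by blast
  qed
  have key: "D (vector [a', b', 0, 0]) \<bullet> vector [a, b, 0, 0] =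
      - (\<nu> 0 $ 3 * ((pd1 (pd1 f1) 0 * a' + pd2 (pd1 f1) 0 * b') * a + (pd1 (pd2 f1) 0 * a' + pd2 (pd2 f1) 0 * b') * b)
       + \<nu> 0 $ 4 * ((pd1 (pd1 f2) 0 * a' + pd2 (pd1 f2) 0 * b') * a + (pd1 (pd2 f2) 0 * a' + pd2 (pd2 f2) 0 * b') * b))" for a b a' b'
  proof -
    define R where "R q = (vector [a, b, pd1 f1 q * a + pd2 f1 q * b, pd1 f2 q * a + pd2 f2 q * b] :: real^4)" for q
    define R' where "R' v = (vector [0, 0,
      (pd1 (pd1 f1) 0 * fst v + pd2 (pd1 f1) 0 * snd v) * a + (pd1 (pd2 f1) 0 * fst v + pd2 (pd2 f1) 0 * snd v) * b,
      (pd1 (pd1 f2) 0 * fst v + pd2 (pd1 f2) 0 * snd v) * a + (pd1 (pd2 f2) 0 * fst v + pd2 (pd2 f2) 0 * snd v) * b] :: real^4)"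
      for v :: "real \<times> real"
    have "(R has_derivative R') (at 0)"
      unfolding R_def[abs_def] R'_def[abs_def] vector_4_eq scaleR_zero_left
      by (intro has_derivative_add has_derivative_scaleR_left has_derivative_mult_left
         has_derivative_const smooth_near_pd smooth_near_partials f0)
    from has_derivative_inner[OF ND this]
    have D1: "((\<lambda>q. N q \<bullet> R q) has_derivative (\<lambda>v. N 0 \<bullet> R' v + D (vector [fst v, snd v, 0, 0]) \<bullet> R 0)) (at 0)" .
    have ev: "\<forall>\<^sub>F q in nhds 0. N q \<bullet> R q = 0" using orth[of a b] unfolding R_def .
    have "((\<lambda>q. 0) has_derivative (\<lambda>v. N 0 \<bullet> R' v + D (vector [fst v, snd v, 0, 0]) \<bullet> R 0)) (at 0)"
      by (rule has_derivative_transform_eventually[OF D1])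
         (use ev eventually_nhds_x_imp_x[OF ev] in \<open>auto simp: eventually_at_filter elim: eventually_mono\<close>)
    then have "(\<lambda>v. N 0 \<bullet> R' v + D (vector [fst v, snd v, 0, 0]) \<bullet> R 0) = (\<lambda>_. 0)"
      using has_derivative_unique has_derivative_const by blast
    from fun_cong[OF this, of "(a', b')"] show ?thesis
      by (simp add: R_def R'_def N0 pd0 inner_4)
  qed
  have ax: "axis 1 1 = (vector [1, 0, 0, 0] :: real^4)" "axis 2 1 = (vector [0, 1, 0, 0] :: real^4)"
    by (simp_all add: vec_eq_iff forall_4 axis_def)
  note mix = mixed_partials_commute[OF f0(1)] mixed_partials_commute[OF f0(2)]
  show "D (axis 1 1) $ 1 = - (\<nu> 0 $ 3 * pd1 (pd1 f1) 0 + \<nu> 0 $ 4 * pd1 (pd1 f2) 0)"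
    using key[of 1 0 1 0] by (simp add: ax inner_4)
  show "D (axis 2 1) $ 1 = - (\<nu> 0 $ 3 * pd2 (pd1 f1) 0 + \<nu> 0 $ 4 * pd2 (pd1 f2) 0)"
    using key[of 0 1 1 0] by (simp add: ax inner_4)
  show "D (axis 1 1) $ 2 = - (\<nu> 0 $ 3 * pd2 (pd1 f1) 0 + \<nu> 0 $ 4 * pd2 (pd1 f2) 0)"
    using key[of 1 0 0 1] by (simp add: ax inner_4 mix)
  show "D (axis 2 1) $ 2 = - (\<nu> 0 $ 3 * pd2 (pd2 f1) 0 + \<nu> 0 $ 4 * pd2 (pd2 f2) 0)"
    using key[of 0 1 0 1] by (simp add: ax inner_4)
qed

lemma lipschitz_killing_curvature_monge:
  assumes M: "in_monge_form M f1 f2" and \<nu>: "normal_field M 0 \<nu>"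
  shows "lipschitz_killing_curvature M \<nu> =
    (\<nu> 0 $ 3 * pd1 (pd1 f1) 0 + \<nu> 0 $ 4 * pd1 (pd1 f2) 0) * (\<nu> 0 $ 3 * pd2 (pd2 f1) 0 + \<nu> 0 $ 4 * pd2 (pd2 f2) 0)
    - (\<nu> 0 $ 3 * pd2 (pd1 f1) 0 + \<nu> 0 $ 4 * pd2 (pd1 f2) 0)\<^sup>2"
  unfolding lipschitz_killing_curvature_def shape_operator_def tangent_space_monge[OF M] closest_point_horizontal
  by (simp add: Let_def inner_axis det_2 normal_field_derivative[OF M \<nu>] power2_eq_square add.commute)


section \<open>Curvature of the surface from its apparent contour\<close>

theorem theorem6:
  fixes M \<pi> :: "(real^4) set"
    and f1 f2 :: "real \<times> real \<Rightarrow> real"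
    and \<alpha> l \<mu> \<beta> :: real
    and u v w :: "real^4"
    and \<nu> :: "real^4 \<Rightarrow> real^4"
  assumes "in_monge_form M f1 f2"
    and "u = vector [1, \<alpha>, 0, 0]"
    and "v = vector [0, l, \<mu>, \<beta>]"
    and "\<mu>\<^sup>2 + \<beta>\<^sup>2 \<noteq> 0"
    and "w = vector [0, 0, \<beta>, - \<mu>]"
    and "\<pi> = span {u, v}"
    and "dim (tangent_space M 0 \<inter> \<pi>) = 1"
    and "u \<in> tangent_space M 0 \<inter> \<pi>"
    and "fold_singularity (surface_proj \<alpha> l \<mu> \<beta> f1 f2)"
    and "normal_field M 0 \<nu>"
    and "\<nu> 0 = w"
  shows "lipschitz_killing_curvature M \<nu> =
         apparent_contour_curvature (surface_proj \<alpha> l \<mu> \<beta> f1 f2) * koenderink_factor f1 f2 u w"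
proof -
  \<comment> \<open>The factors 1 give \<open>p\<close> the shape of nested linear combinations, to which the rules for
    derivatives of such combinations apply.\<close>
  define p where "p q = 1 * (1 * snd q + - \<alpha> * fst q) + - (l / (\<mu>\<^sup>2 + \<beta>\<^sup>2)) * (\<mu> * f1 q + \<beta> * f2 q)" for q
  define h where "h q = \<beta> * f1 q + - \<mu> * f2 q" for q
  have P: "surface_proj \<alpha> l \<mu> \<beta> f1 f2 = (\<lambda>q. (p q, h q))"
    by (auto simp: surface_proj_def proj_along_def monge_def p_def h_def)
  have z: "zero_1jet f1" "zero_1jet f2" and f: "smooth_near 0 f1" "smooth_near 0 f2"
    using assms(1) unfolding in_monge_form_def smooth_near_def by blast+
  note pd0 = zero_1jet_pd[OF z(1)] zero_1jet_pd[OF z(2)]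
  have coord: "smooth_near 0 (fst :: real \<times> real \<Rightarrow> real)" "smooth_near 0 (snd :: real \<times> real \<Rightarrow> real)"
    by (intro smooth_near_bounded_linear bounded_linear_fst bounded_linear_snd)+
  have pd_coord: "pd1 fst 0 = 1" "pd2 fst 0 = 0" "pd1 snd 0 = 0" "pd2 snd 0 = 1"
    by (simp_all add: pd1_def pd2_def zero_prod_def)
  have h: "smooth_near 0 h" "h 0 = 0" "pd1 h 0 = 0" "pd2 h 0 = 0"
    unfolding h_def[abs_def] by (simp_all only: smooth_near_lincomb pd_lincomb f) (simp_all add: pd0)
  have p: "smooth_near 0 p" "p 0 = 0" "pd2 p 0 = 1" and p1: "pd1 p 0 = - \<alpha>"
    unfolding p_def[abs_def] by (simp_all only: smooth_near_lincomb pd_lincomb f coord) (simp_all add: pd0 pd_coord)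
  have h2: "pd1 (pd1 h) 0 = \<beta> * pd1 (pd1 f1) 0 + - \<mu> * pd1 (pd1 f2) 0"
    "pd2 (pd1 h) 0 = \<beta> * pd2 (pd1 f1) 0 + - \<mu> * pd2 (pd1 f2) 0"
    "pd2 (pd2 h) 0 = \<beta> * pd2 (pd2 f1) 0 + - \<mu> * pd2 (pd2 f2) 0"
    unfolding h_def[abs_def] by (rule second_pd_lincomb[OF f])+
  have "lipschitz_killing_curvature M \<nu> = pd1 (pd1 h) 0 * pd2 (pd2 h) 0 - (pd2 (pd1 h) 0)\<^sup>2"
    unfolding lipschitz_killing_curvature_monge[OF assms(1,10)] assms(11) assms(5) h2 by (simp add: mult.commute)
  also have "\<dots> = apparent_contour_curvature (\<lambda>q. (p q, h q)) *
      (pd1 (pd1 h) 0 - 2 * pd1 p 0 * pd2 (pd1 h) 0 + (pd1 p 0)\<^sup>2 * pd2 (pd2 h) 0)"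
    using apparent_contour_curvature_of_fold[OF assms(9)[unfolded P] p h] by simp
  also have "pd1 (pd1 h) 0 - 2 * pd1 p 0 * pd2 (pd1 h) 0 + (pd1 p 0)\<^sup>2 * pd2 (pd2 h) 0 = koenderink_factor f1 f2 u w"
    unfolding koenderink_factor_def second_fundamental_form_def assms(2,5) h2 p1
    by (simp add: Let_def inner_4 axis_def algebra_simps)
  finally show ?thesis unfolding P .
qed

end
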